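(* Let $q>1$, $\alpha>-1$, $\sigma>1$, and let $\mu$ be a positive Borel measure on $\mathbb{D}$. Fix $t>0$. Then the following conditions are equivalent: (a) There is a constant $C>0$ such that for every analytic function $f$ on $\mathbb{D}$, $$\Big\| \xi\mapsto \int_{\Gamma_\sigma(\xi)} \frac{|f(z)|}{1-|z|}\, d\mu(z) \Big\|_{L^{q,\infty}(\mathbb{T})} \le C \Big\| \xi\mapsto\int_{\Gamma_\sigma(\xi)} |f(z)|(1-|z|)^{\alpha-1}\, dm_2(z) \Big\|_{L^{q,\infty}(\mathbb{T})}.$$ (b) There is $C>0$ such that $\mu(D(z,t)) \le C(1-|z|)^{\alpha+2}$ for all $z\in\mathbb{D}$. (c) There is $C>0$ such that $\mu(\square I)\le C|I|^{\alpha+2}$ for every arc $I\subset\mathbb{T}$.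
   Context: $\mathbb{D}$ is the unit disk, $\mathbb{T}$ the unit circle, $dm_2$ normalized area measure on $\mathbb{D}$, $dm$ Lebesgue arc-length measure on $\mathbb{T}$, and $|I|$ the length of an arc $I$. The Lusin cone is $\Gamma_\sigma(\xi)=\{z\in\mathbb{D}: |1-\bar\xi z|<\sigma(1-|z|)\}$ for $\xi\in\mathbb{T}$, $\sigma>1$. The Carleson box of an arc $I\subset\mathbb{T}$ is $\square I=\{re^{i\varphi}: 1-|I|<r<1,\ e^{i\varphi}\in I\}$. $L^{q,\infty}(\mathbb{T})$ is the weak $L^q$ (Lorentz) space with quasinorm $\|g\|_{L^{q,\infty}}=\sup_{\lambda>0}\lambda\, m(\{\xi\in\mathbb{T}:|g(\xi)|>\lambda\})^{1/q}$. For $a\in\mathbb{D}$, $\varphi_a(z)=\frac{a-z}{1-\bar a z}$; the Bergman distance is $d(z,w)=\frac12\log\frac{1+|\varphi_w(z)|}{1-|\varphi_w(z)|}$, and the Bergman disk is $D(a,t)=\{w\in\mathbb{D}: d(w,a)<t\}$ for $t>0$. *)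

theory Defs
  imports "HOL-Analysis.Analysis"
begin

definition circle_measure :: "complex measure" where
  "circle_measure = distr (restrict_space lborel {0..<2*pi}) borel cis"

definition area_measure :: "complex measure" where
  "area_measure = density lborel (\<lambda>z. ennreal (1/pi) * indicator (ball 0 1) z)"

definition lusin_cone :: "real \<Rightarrow> complex \<Rightarrow> complex set" where
  "lusin_cone \<sigma> \<xi> = {z \<in> ball 0 1. norm (1 - cnj \<xi> * z) < \<sigma> * (1 - norm z)}"

definition weak_Lq_norm :: "real \<Rightarrow> (complex \<Rightarrow> ennreal) \<Rightarrow> ennreal" where
  "weak_Lq_norm q g = (SUP s\<in>{0<..}.
     ennreal (s * (measure circle_measure {\<xi> \<in> sphere 0 1. ennreal s < g \<xi>}) powr (1/q)))"

definition mobius :: "complex \<Rightarrow> complex \<Rightarrow> complex" where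
  "mobius a z = (a - z) / (1 - cnj a * z)"

definition bergman_dist :: "complex \<Rightarrow> complex \<Rightarrow> real" where
  "bergman_dist z w = (1/2) * ln ((1 + norm (mobius w z)) / (1 - norm (mobius w z)))"

definition bergman_disk :: "complex \<Rightarrow> real \<Rightarrow> complex set" where
  "bergman_disk a t = {w \<in> ball 0 1. bergman_dist w a < t}"

text \<open>Closed arc starting at angle a of length h (0 < h \<le> 2 pi).\<close>
definition arc :: "real \<Rightarrow> real \<Rightarrow> complex set" where
  "arc a h = cis ` {a..a+h}"

text \<open>Carleson box of an arc I of length h.\<close>
definition carleson_box :: "complex set \<Rightarrow> real \<Rightarrow> complex set" where
  "carleson_box I h = {complex_of_real r * cis \<phi> | r \<phi>. 0 \<le> r \<and> 1 - h < r \<and> r < 1 \<and> cis \<phi> \<in> I}"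

end

theory Submission
  imports "HOL-Complex_Analysis.Cauchy_Integral_Formula" Defs
begin

text \<open>
  Write $\delta_z = 1 - |z|$. For $|\xi| = 1$ the cone condition reads $|\xi - z| < \sigma\delta_z$, so the set of
  vertices whose cone contains $z$ is the trace on the circle of a Euclidean disk about $z$ of
  radius comparable to $\delta_z$. Condition (c) is the hub. Euclidean disks of radius $\epsilon\delta_z$ and
  Bergman disks are comparable, and a Carleson box is covered by geometrically shrinking layers of
  such disks; this gives (b) $\Leftrightarrow$ (c).

  For (a) $\Rightarrow$ (c), test with $f(w) = (1 - \bar z w)^{-n}$, $n$ large: the right-hand side is of order
  $\delta_z^{\alpha+1-n+1/q}$, while the left-hand side is at least of order
  $\mu(\{|w - z| < \epsilon\delta_z\})\, \delta_z^{-n-1+1/q}$.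

  For (c) $\Rightarrow$ (a), let $E$ be a superlevel set of the left-hand side. Tonelli's theorem, the area
  sub-mean value inequality and (c) bound the integral of the left-hand side over $E$ by the integral of
  $|f(w)|\delta_w^{\alpha-1}\, m(E \cap \{|\xi - w| < K\delta_w\})$. The relative density of $E$ in these arcs is
  decomposed dyadically; by the Vitali covering lemma the arcs of density about $2^{-j}$ fill a set
  $S_j$ with $m(S_j) \lesssim 2^j m(E)$, and a weak $L^q$ function has integral at most a multiple of
  $m(S_j)^{1-1/q}$ over $S_j$. As $q > 1$ the sum over $j$ converges to a multiple of $m(E)^{1-1/q}$. This is
  the duality with the Hardy-Littlewood maximal function, written out on level sets.
\<close>

section \<open>The circle measure and the area sub-mean value inequality\<close>

text \<open>The quasinorm is formed with \<open>measure\<close>, which is 0 on a set that is not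
  measurable, so a superlevel set must be shown Borel before a lower bound on its size is usable.
  Under (a) nothing makes \<open>\<mu>\<close> sigma-finite and Tonelli cannot supply this; lower
  semicontinuity of cone integrals in the vertex does. Once disks are controlled,
  \<open>\<mu>\<close> is finite and Tonelli applies. Averaging |f| over disks enlarges the aperture
  from \<open>\<sigma>\<close> to \<open>2 * \<sigma> + 1\<close>. The density sets bring it back:
  if the wide arc of w has density about 2^(-j), it lies entirely in S_j, so m(E in the wide arc) is
  at most a constant times 2^(-j) m(S_j in the \<open>\<sigma>\<close>-arc). Tonelli read backwards
  then gives the integral over S_j of the original right-hand function. Each j contributes 2^(-j)
  (2^j)^(1-1/q) = 2^(-j/q), while q > 1 makes weak L^q functions integrable over sets. With E the
  superlevel set at height s this reads s m(E) <= C N m(E)^(1-1/q). The circle has finite measure,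
  so the power of m(E) can be divided out without knowing in advance that the left-hand norm is
  finite.\<close>

lemma lborel_complex_eq_distr_vec2:
  "(lborel :: complex measure) = distr (lborel :: (real^2) measure) borel (\<lambda>x. Complex (x$1) (x$2))"
proof (rule lborel_eqI)
  fix l u :: complex
  assume lu: "\<And>b. b \<in> Basis \<Longrightarrow> l \<bullet> b \<le> u \<bullet> b"
  have le: "Re l \<le> Re u" "Im l \<le> Im u"
    using lu[of 1] lu[of \<i>] by (auto simp: Basis_complex_def inner_complex_def)
  have m: "(\<lambda>x::real^2. Complex (x$1) (x$2)) \<in> borel_measurable lborel"
    by (simp, intro borel_measurable_continuous_onI continuous_intros)
  have pre: "(\<lambda>x::real^2. Complex (x$1) (x$2)) -` box l u = box (vector [Re l, Im l]) (vector [Re u, Im u])"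
    by (auto simp: in_box_complex_iff mem_box_cart forall_2)
  have "emeasure (distr (lborel :: (real^2) measure) borel (\<lambda>x. Complex (x$1) (x$2))) (box l u)
     = emeasure lborel (box (vector [Re l, Im l]) (vector [Re u, Im u] :: real^2))"
    using m by (subst emeasure_distr) (auto simp: pre)
  also have "\<dots> = ennreal ((Re u - Re l) * (Im u - Im l))"
    using le by (subst emeasure_lborel_box_eq)
      (auto simp: Basis_vec_def inner_axis axis_eq_axis UNIV_2 prod.insert)
  finally show "emeasure (distr (lborel :: (real^2) measure) borel (\<lambda>x. Complex (x$1) (x$2))) (box l u)
     = ennreal (prod ((\<bullet>) (u - l)) Basis)"
    by (simp add: Basis_complex_def inner_complex_def)
qed simp


text \<open>Rotation invariance lets \<open>area_submean\<close> average over the angle without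
  polar coordinates. It is imported from \<open>real^2\<close>, where orthogonal maps are known to
  preserve Lebesgue measure; checking boxes suffices.\<close>

lemma lborel_complex_rotate:
  "distr lborel borel ((*) (cis \<theta>)) = (lborel :: complex measure)"
proof (rule lborel_eqI[symmetric])
  fix l u :: complex
  assume lu: "\<And>b. b \<in> Basis \<Longrightarrow> l \<bullet> b \<le> u \<bullet> b"
  define E where "E = (\<lambda>x::real^2. Complex (x$1) (x$2))"
  \<comment> \<open>Rotation by \<open>- \<theta>\<close>, inverse to multiplication by
    \<open>cis \<theta>\<close>: the preimage of a box becomes the image of a box, the form that
    \<open>measure_orthogonal_image\<close> handles.\<close>
  define R where "R = (\<lambda>x::real^2. vector [cos \<theta> * x$1 + sin \<theta> * x$2, cos \<theta> * x$2 - sin \<theta> * x$1] :: real^2)"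
  have ER: "cis \<theta> * E (R x) = E x" for x
  proof -
    have *: "cos \<theta> * (cos \<theta> * y) + sin \<theta> * (sin \<theta> * y) = y" for y
    proof -
      have "cos \<theta> * (cos \<theta> * y) + sin \<theta> * (sin \<theta> * y) = ((sin \<theta>)\<^sup>2 + (cos \<theta>)\<^sup>2) * y"
        by (simp only: power2_eq_square algebra_simps)
      thus ?thesis by simp
    qed
    show ?thesis by (simp add: E_def R_def complex_eq_iff algebra_simps *)
  qed
  have ER': "R x = y" if "cis \<theta> * E y = E x" for x y
  proof -
    have "cis \<theta> * E (R x) = cis \<theta> * E y" using ER that by simp
    hence "E (R x) = E y" by simp
    thus ?thesis by (simp add: E_def vec_eq_iff forall_2)
  qed
  have surjE: "\<exists>x. E x = z" for z
    by (rule exI[of _ "vector [Re z, Im z]"]) (simp add: E_def)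
  have bE: "E -` (\<lambda>z. cis \<theta> * z) -` box l u = R ` (E -` box l u)"
  proof (intro equalityI subsetI)
    fix y assume y: "y \<in> E -` (\<lambda>z. cis \<theta> * z) -` box l u"
    obtain x where "E x = cis \<theta> * E y" using surjE by blast
    thus "y \<in> R ` (E -` box l u)" using ER'[of y x] y by (intro image_eqI[of _ _ x]) auto
  qed (auto simp: ER)
  have oR: "orthogonal_transformation R"
    unfolding orthogonal_transformation
  proof
    show "linear R"
      by (auto simp: linear_iff R_def vec_eq_iff forall_2 algebra_simps)
    have "norm (R v) = norm v" for v
    proof -
      have "(cos \<theta> * a + sin \<theta> * b)\<^sup>2 + (cos \<theta> * b - sin \<theta> * a)\<^sup>2 = a\<^sup>2 + b\<^sup>2" for a b
      proof -
        have "(cos \<theta> * a + sin \<theta> * b)\<^sup>2 + (cos \<theta> * b - sin \<theta> * a)\<^sup>2 = ((sin \<theta>)\<^sup>2 + (cos \<theta>)\<^sup>2) * (a\<^sup>2 + b\<^sup>2)"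
          by (simp add: power2_eq_square algebra_simps del: sin_cos_squared_add sin_cos_squared_add2 sin_cos_squared_add3)
        thus ?thesis by simp
      qed
      thus ?thesis by (simp add: norm_vec_def L2_set_def R_def sum_2)
    qed
    thus "\<forall>v. norm (R v) = norm v" by blast
  qed
  have mE: "E \<in> borel_measurable borel"
    unfolding E_def by (intro borel_measurable_continuous_onI continuous_intros)
  have Eb: "emeasure (lborel :: complex measure) A = emeasure lborel (E -` A)" if "A \<in> sets borel" for A
    using that mE by (subst lborel_complex_eq_distr_vec2) (auto simp: emeasure_distr E_def)
  have bx: "E -` box l u \<in> sets borel" using measurable_sets[OF mE, of "box l u"] by simp
  have "emeasure lborel (E -` box l u) < \<infinity>"
    using Eb[of "box l u"] emeasure_lborel_box_finite[of l u] by simp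
  hence lm: "E -` box l u \<in> lmeasurable"
    using bx by (intro fmeasurableI) auto
  have mrot: "(\<lambda>z. cis \<theta> * z) \<in> borel_measurable borel" by simp
  hence rb: "(\<lambda>z. cis \<theta> * z) -` box l u \<in> sets borel"
    using measurable_sets[OF mrot, of "box l u"] by simp
  have Rb: "R ` (E -` box l u) \<in> sets borel"
    using measurable_sets[OF mE rb] by (simp add: bE)
  have "emeasure (distr lborel borel ((*) (cis \<theta>))) (box l u) = emeasure lborel (R ` (E -` box l u))"
    using mrot rb by (subst emeasure_distr) (auto simp: Eb bE)
  also have "\<dots> = emeasure lebesgue (R ` (E -` box l u))" using Rb by simp
  also have "\<dots> = emeasure lebesgue (E -` box l u)"
    by (simp only: emeasure_eq_measure2[OF lm] emeasure_eq_measure2[OF measurable_orthogonal_image[OF oR lm]]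
        measure_orthogonal_image[OF oR lm])
  also have "\<dots> = emeasure lborel (box l u)" using bx by (simp add: Eb)
  finally show "emeasure (distr lborel borel ((*) (cis \<theta>))) (box l u) = ennreal (prod ((\<bullet>) (u - l)) Basis)"
    using lu by (simp add: emeasure_lborel_box_eq)
qed simp

section \<open>Arc length on the circle: parametrization, chords, and the measure of plane
  balls\<close>

lemma sets_circle_measure [simp, measurable_cong]: "sets circle_measure = sets borel"
  by (simp add: circle_measure_def)

lemma space_circle_measure [simp]: "space circle_measure = UNIV"
  by (simp add: circle_measure_def)

lemma measurable_cis [measurable]: "cis \<in> borel_measurable borel"
  using continuous_on_cis[OF continuous_on_id[of UNIV]] by (intro borel_measurable_continuous_onI)

lemma vimage_cis_borel: "A \<in> sets borel \<Longrightarrow> cis -` A \<in> sets borel"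
  using measurable_sets[OF measurable_cis, of A] by simp

lemma emeasure_circle_measure:
  assumes "A \<in> sets borel"
  shows "emeasure circle_measure A = emeasure lborel ({0..<2*pi} \<inter> cis -` A)"
proof -
  have "cis \<in> borel_measurable (restrict_space lborel {0..<2*pi})"
    by (rule measurable_restrict_space1) simp
  thus ?thesis
    unfolding circle_measure_def using assms vimage_cis_borel[OF assms]
    by (subst emeasure_distr) (auto simp: emeasure_restrict_space Int_commute space_restrict_space)
qed

lemma emeasure_circle_UNIV: "emeasure circle_measure UNIV = ennreal (2*pi)"
  by (simp add: emeasure_circle_measure)

interpretation circle: finite_measure circle_measure
  by standard (simp add: emeasure_circle_UNIV)

text \<open>\<open>circle_measure\<close> is a measure on the whole plane that charges only the
  circle. Hence plane balls can stand for arcs below.\<close>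

lemma circle_measure_off_sphere: "emeasure circle_measure (- sphere 0 1) = 0"
proof -
  have "cis -` (- sphere 0 1) = {}" by auto
  thus ?thesis by (subst emeasure_circle_measure) auto
qed

text \<open>Factoring out the midpoint \<open>cis ((a+b)/2)\<close> leaves the difference of two
  conjugate unit numbers, which is purely imaginary.\<close>

lemma norm_cis_diff: "norm (cis a - cis b) = 2 * \<bar>sin ((a - b) / 2)\<bar>"
proof -
  have "cis a - cis b = cis ((a+b)/2) * (2 * \<i> * sin ((a-b)/2))"
  proof -
    have "cis a = cis ((a+b)/2) * cis ((a-b)/2)" "cis b = cis ((a+b)/2) * cis (-((a-b)/2))"
      by (simp_all only: cis_mult) (simp_all add: field_simps)
    moreover have "cis x - cis (-x) = 2 * \<i> * sin x" for x
      by (simp add: complex_eq_iff)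
    ultimately show ?thesis by (metis right_diff_distrib)
  qed
  thus ?thesis by (simp add: norm_mult)
qed

lemma norm_cis_diff_le: "norm (cis a - cis b) \<le> \<bar>a - b\<bar>"
  using abs_sin_le_one abs_sin_x_le_abs_x[of "(a-b)/2"] by (simp add: norm_cis_diff)

text \<open>Jordan's inequality: sine is concave on \<open>{0..pi/2}\<close> and so lies above the
  chord joining its end points.\<close>

lemma sin_ge_linear: assumes "0 \<le> x" "x \<le> pi/2" shows "sin x \<ge> 2/pi * x"
proof -
  have "convex_on {0..pi/2} (\<lambda>x. - sin x)"
    by (rule f''_ge0_imp_convex[where f'="\<lambda>x. - cos x" and f''="\<lambda>x. sin x"])
       (auto intro!: derivative_eq_intros sin_ge_zero)
  from convex_onD[OF this, of "2/pi*x" 0 "pi/2"] show ?thesis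
    using assms by (simp add: field_simps)
qed

lemma norm_cis_diff_ge: assumes "\<bar>a - b\<bar> \<le> pi" shows "norm (cis a - cis b) \<ge> 2/pi * \<bar>a - b\<bar>"
proof -
  have "\<bar>sin x\<bar> = sin \<bar>x\<bar>" if "\<bar>x\<bar> \<le> pi/2" for x :: real
    using that sin_ge_zero[of "\<bar>x\<bar>"] by (cases "x \<ge> 0") auto
  from this[of "(a-b)/2"] have "\<bar>sin ((a - b) / 2)\<bar> = sin (\<bar>a - b\<bar> / 2)"
    using assms by simp
  thus ?thesis using sin_ge_linear[of "\<bar>a-b\<bar>/2"] assms by (simp add: norm_cis_diff)
qed

text \<open>If the ball meets the circle at \<open>cis \<theta>0\<close>, its other circle points
  have chord distance less than \<open>2*r\<close> from there, hence angular distance less than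
  \<open>pi*r\<close> modulo \<open>2*pi\<close>. The cut of the parameter interval may split this
  arc; three translates of an interval of length \<open>2*pi*r\<close> account for it and give
  \<open>6*pi*r\<close>.\<close>

lemma circle_measure_ball_le:
  fixes c :: complex
  assumes "r > 0"
  shows "emeasure circle_measure (ball c r) \<le> ennreal (6*pi*r)"
proof (cases "\<exists>\<theta>0\<in>{0..<2*pi}. cis \<theta>0 \<in> ball c r")
  case False
  hence "{0..<2*pi} \<inter> cis -` ball c r = {}" by auto
  thus ?thesis by (simp add: emeasure_circle_measure)
next
  case True
  then obtain \<theta>0 where t0: "\<theta>0 \<in> {0..<2*pi}" "cis \<theta>0 \<in> ball c r" by blast
  define I where "I = (\<lambda>c::real. {c - pi*r..c + pi*r})"
  have "{0..<2*pi} \<inter> cis -` ball c r \<subseteq> I \<theta>0 \<union> I (\<theta>0 + 2*pi) \<union> I (\<theta>0 - 2*pi)"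
  proof
    fix \<theta> assume "\<theta> \<in> {0..<2*pi} \<inter> cis -` ball c r"
    hence th: "\<theta> \<in> {0..<2*pi}" "cis \<theta> \<in> ball c r" by auto
    have near: "norm (cis \<theta> - cis \<theta>0) < 2*r"
      using th t0 dist_triangle[of "cis \<theta>" "cis \<theta>0" c] by (simp add: dist_norm norm_minus_commute)
    consider "\<bar>\<theta> - \<theta>0\<bar> \<le> pi" | "\<theta> - \<theta>0 > pi" | "\<theta> - \<theta>0 < - pi" by linarith
    then obtain \<theta>' where t': "\<theta>' \<in> {\<theta>, \<theta> - 2*pi, \<theta> + 2*pi}" "\<bar>\<theta>' - \<theta>0\<bar> \<le> pi"
    proof cases
      case 1 thus ?thesis by (intro that[of \<theta>]) auto
    next
      case 2 thus ?thesis using th(1) t0(1) by (intro that[of "\<theta> - 2*pi"]) auto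
    next
      case 3 thus ?thesis using th(1) t0(1) by (intro that[of "\<theta> + 2*pi"]) auto
    qed
    have "cis \<theta>' = cis \<theta>" using t'(1) by (auto simp: complex_eq_iff cos_diff sin_diff)
    hence "2/pi * \<bar>\<theta>' - \<theta>0\<bar> < 2*r" using norm_cis_diff_ge[OF t'(2)] near by simp
    hence "\<bar>\<theta>' - \<theta>0\<bar> < pi*r" by (simp add: field_simps)
    thus "\<theta> \<in> I \<theta>0 \<union> I (\<theta>0 + 2*pi) \<union> I (\<theta>0 - 2*pi)"
      using t'(1) by (auto simp: I_def abs_if split: if_splits)
  qed
  hence "emeasure circle_measure (ball c r) \<le> emeasure lborel (I \<theta>0 \<union> I (\<theta>0 + 2*pi) \<union> I (\<theta>0 - 2*pi))"
    by (subst emeasure_circle_measure) (auto intro!: emeasure_mono simp: I_def)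
  also have "\<dots> \<le> emeasure lborel (I \<theta>0) + emeasure lborel (I (\<theta>0 + 2*pi)) + emeasure lborel (I (\<theta>0 - 2*pi))"
    by (intro order_trans[OF emeasure_subadditive] add_mono order_refl) (auto simp: I_def)
  also have "\<dots> = ennreal (6*pi*r)"
    using assms by (simp add: I_def flip: ennreal_plus)
  finally show ?thesis .
qed

text \<open>The radial projection of \<open>w\<close> to the circle is at distance
  \<open>1 - norm w\<close>, so a radius \<open>K\<close> times as large leaves slack
  \<open>(K - 1) * (1 - norm w)\<close> for moving along the circle.\<close>

lemma circle_measure_ball_ge:
  assumes "norm w < 1" "K > 1"
  shows "emeasure circle_measure (ball w (K * (1 - norm w))) \<ge> ennreal (min (K - 1) 1 * (1 - norm w))"
proof -
  define d where "d = 1 - norm w"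
  define x where "x = min (K - 1) 1 * d"
  have d: "0 < d" "d \<le> 1" using assms by (auto simp: d_def)
  have x: "0 < x" "x \<le> 1" "x \<le> (K-1)*d"
    using d assms by (auto simp: x_def min_def mult_le_one)
  obtain \<phi> where phi: "0 \<le> \<phi>" "\<phi> < 2*pi" "w = of_real (norm w) * cis \<phi>"
    using Arg2pi[of w] by (auto simp: is_Arg_def cis_conv_exp)
  have near: "cis \<theta> \<in> ball w (K*d)" if "\<bar>\<theta> - \<phi>\<bar> < x" for \<theta>
  proof -
    have "norm (cis \<phi> - w) = norm (of_real d * cis \<phi>)"
      by (subst phi(3)) (simp add: d_def algebra_simps)
    hence "norm (cis \<phi> - w) = d" using d by (simp add: norm_mult)
    moreover have "norm (cis \<theta> - cis \<phi>) < x" using norm_cis_diff_le[of \<theta> \<phi>] that by simp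
    ultimately have "norm (cis \<theta> - w) < d + x"
      using norm_triangle_ineq[of "cis \<theta> - cis \<phi>" "cis \<phi> - w"] by simp
    also have "\<dots> \<le> K * d" using x(3) by (simp add: algebra_simps)
    finally show ?thesis by (simp add: dist_norm norm_minus_commute)
  qed
  \<comment> \<open>One side of \<open>\<phi>\<close> always has room inside
    \<open>{0..<2*pi}\<close>, because \<open>x \<le> 1 < pi\<close>; a one-sided interval avoids
    the cut. This is why the constant is capped by \<open>min (K - 1) 1\<close>.\<close>
  obtain J where J: "J \<in> {{\<phi><..<\<phi>+x}, {\<phi>-x<..<\<phi>}}" "J \<subseteq> {0..<2*pi}"
  proof (cases "\<phi> \<le> pi")
    case True thus ?thesis using phi x pi_gt3 by (intro that[of "{\<phi><..<\<phi>+x}"]) auto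
  next
    case False thus ?thesis using phi x pi_gt3 by (intro that[of "{\<phi>-x<..<\<phi>}"]) auto
  qed
  have "ennreal x = emeasure lborel J" using J(1) x by auto
  also have "\<dots> \<le> emeasure lborel ({0..<2*pi} \<inter> cis -` ball w (K*d))"
  proof (rule emeasure_mono)
    show "J \<subseteq> {0..<2*pi} \<inter> cis -` ball w (K*d)"
      using J near by (auto simp: abs_if)
    show "{0..<2*pi} \<inter> cis -` ball w (K*d) \<in> sets lborel"
      using vimage_cis_borel[of "ball w (K*d)"] by auto
  qed
  also have "\<dots> = emeasure circle_measure (ball w (K*d))" by (simp add: emeasure_circle_measure)
  finally show ?thesis by (simp add: x_def d_def)
qed


section \<open>From Cauchy's formula to the area mean value inequality\<close>

lemma has_integral_mean_value_circle:
  assumes f: "f holomorphic_on cball z r" and r: "r > 0"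
  shows "((\<lambda>\<theta>. f (z + of_real r * cis \<theta>)) has_integral (2 * of_real pi * f z)) {0..2*pi}"
proof -
  have "((\<lambda>u. f u/(u-z)) has_contour_integral (2 * of_real pi * \<i> * f z)) (circlepath z r)"
    using Cauchy_integral_circlepath_simple[OF f, of z] r by simp
  hence "((\<lambda>t. f (z + r * cis t) / (z + r * cis t - z) * r * \<i> * cis t) has_integral 2 * of_real pi * \<i> * f z) {0..2*pi}"
    unfolding circlepath_def by (subst (asm) has_contour_integral_part_circlepath_iff) auto
  also have "(\<lambda>t. f (z + r * cis t) / (z + r * cis t - z) * r * \<i> * cis t) = (\<lambda>t. \<i> * f (z + r * cis t))"
    using r by (auto simp: fun_eq_iff)
  finally have "((\<lambda>t. (-\<i>) * (\<i> * f (z + r * cis t))) has_integral (-\<i>) * (2 * of_real pi * \<i> * f z)) {0..2*pi}"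
    by (rule has_integral_mult_right)
  moreover have "(-\<i>) * (\<i> * x) = x" "(-\<i>) * (2 * of_real pi * \<i> * x) = 2 * of_real pi * x" for x
    by (simp_all add: complex_eq_iff)
  ultimately show ?thesis by (simp only:)
qed

lemma norm_le_circle_mean:
  assumes f: "f holomorphic_on cball z r" and r: "r \<ge> 0"
  shows "ennreal (2*pi * norm (f z)) \<le> (\<integral>\<^sup>+\<theta>. ennreal (norm (f (z + of_real r * cis \<theta>))) * indicator {0..2*pi} \<theta> \<partial>lborel)"
proof -
  have int: "((\<lambda>\<theta>. f (z + of_real r * cis \<theta>)) has_integral (2 * of_real pi * f z)) {0..2*pi}"
  proof (cases "r = 0")
    case True
    thus ?thesis using has_integral_const_real[of "f z" 0 "2*pi"] by (simp add: scaleR_conv_of_real)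
  qed (use has_integral_mean_value_circle[OF f] r in auto)
  have cont: "continuous_on {0..2*pi} (\<lambda>\<theta>. norm (f (z + of_real r * cis \<theta>)))"
    using r by (intro continuous_intros continuous_on_compose2[OF holomorphic_on_imp_continuous_on[OF f]])
       (auto simp: dist_norm norm_mult)
  have hi: "((\<lambda>\<theta>. norm (f (z + of_real r * cis \<theta>))) has_integral
      integral {0..2*pi} (\<lambda>\<theta>. norm (f (z + of_real r * cis \<theta>)))) {0..2*pi}"
    using integrable_continuous_interval[OF cont] by (rule integrable_integral)
  have "2 * pi * norm (f z) = norm (2 * of_real pi * f z)" by (simp add: norm_mult)
  also have "\<dots> \<le> integral {0..2*pi} (\<lambda>\<theta>. norm (f (z + of_real r * cis \<theta>)))"
    unfolding integral_unique[OF int, symmetric]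
    using int hi by (intro integral_norm_bound_integral) auto
  finally have "ennreal (2*pi * norm (f z)) \<le> ennreal (integral {0..2*pi} (\<lambda>\<theta>. norm (f (z + of_real r * cis \<theta>))))"
    by (rule ennreal_leI)
  also have "\<dots> = (\<integral>\<^sup>+\<theta>. ennreal (indicator {0..2*pi} \<theta> * norm (f (z + of_real r * cis \<theta>))) \<partial>lborel)"
    by (rule nn_integral_has_integral_lebesgue[OF _ hi, symmetric]) simp
  also have "\<dots> = (\<integral>\<^sup>+\<theta>. ennreal (norm (f (z + of_real r * cis \<theta>))) * indicator {0..2*pi} \<theta> \<partial>lborel)"
    by (intro nn_integral_cong) (simp add: indicator_def)
  finally show ?thesis .
qed

text \<open>By rotation invariance the integral \<open>I\<close> does not change when
  \<open>F w\<close> is replaced by \<open>F (z + cis \<theta> * w)\<close> on the centred ball.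
  Integrating this over \<open>\<theta>\<close> and exchanging the integrals leaves a circle mean
  inside, which dominates \<open>2*pi * F z\<close>. \<open>F\<close> is a Borel stand-in for |f|,
  since \<open>f\<close> is unrestricted off the ball.\<close>

lemma area_submean:
  fixes F :: "complex \<Rightarrow> real"
  assumes f: "f holomorphic_on ball z r" and r: "r > 0"
    and F: "F \<in> borel_measurable borel" "\<And>w. F w \<ge> 0" "\<And>w. w \<in> ball z r \<Longrightarrow> F w = norm (f w)"
  shows "ennreal (F z * pi * r\<^sup>2) \<le> (\<integral>\<^sup>+w. ennreal (F w) * indicator (ball z r) w \<partial>lborel)"
proof -
  note [measurable] = F(1)
  have [measurable]: "ball (0::complex) r \<in> sets borel" "{0..2*pi} \<in> sets borel" by simp_all
  define I where "I = (\<integral>\<^sup>+w. ennreal (F w) * indicator (ball z r) w \<partial>lborel)"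
  have rot: "I = (\<integral>\<^sup>+w. ennreal (F (z + cis \<theta> * w)) * indicator (ball 0 r) w \<partial>lborel)" for \<theta>
  proof -
    have "I = (\<integral>\<^sup>+w. ennreal (F w) * indicator (ball z r) w \<partial>distr lborel borel ((+) z))"
      by (simp add: I_def lborel_distr_plus)
    also have "\<dots> = (\<integral>\<^sup>+w. ennreal (F (z + w)) * indicator (ball 0 r) w \<partial>lborel)"
      by (subst nn_integral_distr) (auto intro!: nn_integral_cong simp: indicator_def dist_norm)
    also have "\<dots> = (\<integral>\<^sup>+w. ennreal (F (z + w)) * indicator (ball 0 r) w \<partial>distr lborel borel ((*) (cis \<theta>)))"
      by (simp only: lborel_complex_rotate)
    also have "\<dots> = (\<integral>\<^sup>+w. ennreal (F (z + cis \<theta> * w)) * indicator (ball 0 r) w \<partial>lborel)"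
      by (subst nn_integral_distr) (auto intro!: nn_integral_cong simp: indicator_def norm_mult)
    finally show ?thesis .
  qed
  have in0: "ennreal (2*pi * F z) * indicator (ball 0 r) w \<le>
      (\<integral>\<^sup>+\<theta>. ennreal (F (z + cis \<theta> * w)) * indicator (ball 0 r) w * indicator {0..2*pi} \<theta> \<partial>lborel)" for w
  proof (cases "norm w < r")
    case True
    obtain \<phi> where phi: "w = of_real (norm w) * cis \<phi>"
      using Arg2pi[of w] by (auto simp: is_Arg_def cis_conv_exp)
    \<comment> \<open>Precomposing with the rotation by \<open>\<phi>\<close> about \<open>z\<close>
      turns the points of the circle of radius \<open>norm w\<close> into
      \<open>z + cis \<theta> * w\<close>, so the argument of \<open>w\<close> disappears from the
      integrand.\<close>
    have hol: "(\<lambda>u. f (z + cis \<phi> * (u - z))) holomorphic_on cball z (norm w)"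
    proof (rule holomorphic_on_compose_gen[of _ _ f, unfolded o_def])
      show "f holomorphic_on ball z r" by (rule f)
    qed (use True in \<open>auto intro!: holomorphic_intros simp: dist_norm norm_mult norm_minus_commute\<close>)
    have eq: "cis \<phi> * (of_real (norm w) * cis \<theta>) = cis \<theta> * w" for \<theta>
      by (subst (2) phi) (simp only: ac_simps)
    have Fw: "norm (f (z + cis \<theta> * w)) = F (z + cis \<theta> * w)" for \<theta>
      using True by (subst F(3)) (auto simp: dist_norm norm_mult)
    have Fz: "norm (f z) = F z" using r by (subst F(3)) auto
    show ?thesis using norm_le_circle_mean[OF hol] True by (simp add: eq Fw Fz)
  qed auto
  have "ennreal (2*pi) * ennreal (F z * pi * r\<^sup>2) = (\<integral>\<^sup>+w. ennreal (2*pi * F z) * indicator (ball 0 r) (w::complex) \<partial>lborel)"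
    using F(2)[of z] r
    by (subst nn_integral_cmult_indicator) (auto simp: emeasure_ball unit_ball_vol_2 simp flip: ennreal_mult)
  also have "\<dots> \<le> (\<integral>\<^sup>+w. (\<integral>\<^sup>+\<theta>. ennreal (F (z + cis \<theta> * w)) * indicator (ball 0 r) w * indicator {0..2*pi} \<theta> \<partial>lborel) \<partial>lborel)"
    by (intro nn_integral_mono in0)
  also have "\<dots> = (\<integral>\<^sup>+\<theta>. (\<integral>\<^sup>+w. ennreal (F (z + cis \<theta> * w)) * indicator (ball 0 r) w * indicator {0..2*pi} \<theta> \<partial>lborel) \<partial>lborel)"
    by (rule lborel_pair.Fubini') measurable
  also have "\<dots> = (\<integral>\<^sup>+\<theta>. I * indicator {0..2*pi} \<theta> \<partial>lborel)"
  proof (rule nn_integral_cong)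
    fix \<theta> :: real
    show "(\<integral>\<^sup>+w. ennreal (F (z + cis \<theta> * w)) * indicator (ball 0 r) w * indicator {0..2*pi} \<theta> \<partial>lborel) = I * indicator {0..2*pi} \<theta>"
      unfolding rot[of \<theta>] by (rule nn_integral_multc) measurable
  qed
  also have "\<dots> = ennreal (2*pi) * I"
    by (subst nn_integral_cmult_indicator) (auto simp: mult.commute)
  finally show ?thesis
    unfolding I_def by (subst (asm) ennreal_mult_le_mult_iff) auto
qed

section \<open>Bergman disks, Euclidean disks and Carleson boxes\<close>

lemma suminf_ennreal_geometric:
  fixes c x :: real
  assumes "0 \<le> c" "0 \<le> x" "x < 1"
  shows "(\<Sum>k. ennreal (c * x ^ k)) = ennreal (c / (1 - x))"
proof (rule suminf_ennreal_eq)
  show "(\<lambda>k. c * x ^ k) sums (c / (1 - x))"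
    using sums_mult[OF geometric_sums[of x], of c] assms by simp
qed (use assms in simp)

lemma norm_one_minus_cnj_mult:
  "(norm (1 - cnj z * w))\<^sup>2 - (norm (z - w))\<^sup>2 = (1 - (norm z)\<^sup>2) * (1 - (norm w)\<^sup>2)"
  by (simp only: cmod_power2) (simp add: power2_eq_square algebra_simps)

lemma norm_one_minus_cnj_ge:
  assumes "norm w \<le> 1"
  shows "norm (1 - cnj z * w) \<ge> 1 - norm z"
proof -
  have "norm (cnj z * w) \<le> norm z * 1" using assms by (simp add: norm_mult mult_left_le)
  thus ?thesis using norm_triangle_ineq2[of 1 "cnj z * w"] by simp
qed

lemma norm_one_minus_cnj_le:
  assumes "norm z \<le> 1"
  shows "norm (1 - cnj z * w) \<le> 2 * (1 - norm z) + norm (w - z)"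
proof -
  have "1 - cnj z * w = of_real (1 - (norm z)\<^sup>2) - cnj z * (w - z)"
    by (simp add: complex_norm_square algebra_simps del: of_real_power)
  hence "norm (1 - cnj z * w) \<le> norm (of_real (1 - (norm z)\<^sup>2) :: complex) + norm (cnj z * (w - z))"
    by (metis norm_triangle_ineq4)
  also have "norm (of_real (1 - (norm z)\<^sup>2) :: complex) = (1 + norm z) * (1 - norm z)"
  proof -
    have "(norm z)\<^sup>2 \<le> 1" using assms by (simp add: power_le_one)
    hence "norm (of_real (1 - (norm z)\<^sup>2) :: complex) = 1 - (norm z)\<^sup>2" by (simp only: norm_of_real)
    thus ?thesis by (simp add: power2_eq_square algebra_simps)
  qed
  also have "\<dots> \<le> 2 * (1 - norm z)" using assms by (intro mult_right_mono) auto
  also have "norm (cnj z * (w - z)) \<le> norm (w - z)"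
    using assms by (simp add: norm_mult mult_left_le_one_le)
  finally show ?thesis by simp
qed

text \<open>The Bergman distance is artanh of the pseudohyperbolic distance, which is below 1 by
  \<open>norm_one_minus_cnj_mult\<close>. Since artanh is increasing there, Bergman radius
  \<open>t\<close> means pseudohyperbolic radius \<open>tanh t\<close>; the denominator is then
  multiplied out.\<close>

lemma bergman_dist_less_iff:
  assumes "norm z < 1" "norm w < 1"
  shows "bergman_dist w z < t \<longleftrightarrow> norm (w - z) < tanh t * norm (1 - cnj z * w)"
proof -
  define \<rho> where "\<rho> = norm (mobius z w)"
  have pos: "norm (1 - cnj z * w) > 0"
    using norm_one_minus_cnj_ge[of w z] assms by linarith
  have "(norm z)\<^sup>2 < 1" "(norm w)\<^sup>2 < 1" using assms by (auto simp: power_less_one_iff)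
  hence "(norm (z - w))\<^sup>2 < (norm (1 - cnj z * w))\<^sup>2"
    using norm_one_minus_cnj_mult[of z w] mult_pos_pos[of "1 - (norm z)\<^sup>2" "1 - (norm w)\<^sup>2"] by linarith
  hence "norm (z - w) < norm (1 - cnj z * w)" by (rule power_less_imp_less_base) simp
  hence \<rho>: "0 \<le> \<rho>" "\<rho> < 1" using pos by (auto simp: \<rho>_def mobius_def norm_divide)
  have "bergman_dist w z < t \<longleftrightarrow> artanh \<rho> < artanh (tanh t)"
    by (simp add: artanh_tanh_real) (simp add: bergman_dist_def artanh_def \<rho>_def)
  also have "\<dots> \<longleftrightarrow> \<rho> < tanh t"
    using \<rho> tanh_real_bounds[of t] by (simp add: artanh_def field_simps)
  also have "\<dots> \<longleftrightarrow> norm (w - z) < tanh t * norm (1 - cnj z * w)"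
    using pos by (simp add: \<rho>_def mobius_def norm_divide field_simps norm_minus_commute)
  finally show ?thesis .
qed

lemma ball_subset_bergman_disk:
  assumes "norm z < 1" "t > 0"
  shows "ball z (tanh t * (1 - norm z)) \<subseteq> bergman_disk z t"
proof
  fix w assume w: "w \<in> ball z (tanh t * (1 - norm z))"
  have t: "0 < tanh t" "tanh t < 1" using assms by (auto simp: tanh_real_lt_1)
  have "norm (w - z) < tanh t * (1 - norm z)" using w by (simp add: dist_norm norm_minus_commute)
  moreover have "\<dots> \<le> 1 * (1 - norm z)" using t assms by (intro mult_right_mono) auto
  ultimately have "norm w < 1" using norm_triangle_sub[of w z] by simp
  moreover have "norm (w - z) < tanh t * norm (1 - cnj z * w)"
    using \<open>norm (w - z) < _\<close> norm_one_minus_cnj_ge[of w z] \<open>norm w < 1\<close> t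
      mult_left_mono[of "1 - norm z" "norm (1 - cnj z * w)" "tanh t"] by linarith
  ultimately show "w \<in> bergman_disk z t"
    using assms by (simp add: bergman_disk_def bergman_dist_less_iff)
qed

text \<open>The upper bound for \<open>norm (1 - cnj z * w)\<close> contains
  \<open>norm (w - z)\<close> again. As \<open>tanh t < 1\<close>, that term can be absorbed on the
  left, which produces the factor \<open>1 / (1 - tanh t)\<close>.\<close>

lemma bergman_disk_subset_ball:
  assumes "norm z < 1" "t > 0"
  shows "bergman_disk z t \<subseteq> ball z (2 / (1 - tanh t) * (1 - norm z)) \<inter> ball 0 1"
proof
  fix w assume "w \<in> bergman_disk z t"
  hence w: "norm w < 1" "norm (w - z) < tanh t * norm (1 - cnj z * w)"
    using assms by (auto simp: bergman_disk_def bergman_dist_less_iff)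
  have t: "0 < tanh t" "tanh t < 1" using assms by (auto simp: tanh_real_lt_1)
  have "norm (w - z) < tanh t * (2 * (1 - norm z) + norm (w - z))"
    using w(2) mult_left_mono[OF norm_one_minus_cnj_le[of z w], of "tanh t"] assms t by linarith
  also have "\<dots> \<le> 2 * (1 - norm z) + tanh t * norm (w - z)"
    using mult_right_mono[of "tanh t" 1 "2 * (1 - norm z)"] t assms unfolding distrib_left by auto
  finally have "norm (w - z) < 2 / (1 - tanh t) * (1 - norm z)"
    using t by (simp add: field_simps)
  thus "w \<in> ball z (2 / (1 - tanh t) * (1 - norm z)) \<inter> ball 0 1"
    using w by (simp add: dist_norm norm_minus_commute)
qed

text \<open>Makes the Borel measurability of a box visible. The origin has no direction, so it gets
  a disjunct of its own; it belongs to the box as soon as \<open>h > 1\<close>.\<close>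

lemma carleson_box_arc_eq:
  assumes "0 < h"
  shows "carleson_box (arc a h) h = {z. 1 - h < norm z \<and> norm z < 1 \<and> (z = 0 \<or> z / of_real (norm z) \<in> arc a h)}"
proof (intro equalityI subsetI)
  fix z assume "z \<in> carleson_box (arc a h) h"
  then obtain r \<phi> where *: "z = of_real r * cis \<phi>" "0 \<le> r" "1 - h < r" "r < 1" "cis \<phi> \<in> arc a h"
    by (auto simp: carleson_box_def)
  thus "z \<in> {z. 1 - h < norm z \<and> norm z < 1 \<and> (z = 0 \<or> z / of_real (norm z) \<in> arc a h)}"
    by (auto simp: norm_mult)
next
  fix z assume z: "z \<in> {z. 1 - h < norm z \<and> norm z < 1 \<and> (z = 0 \<or> z / of_real (norm z) \<in> arc a h)}"
  show "z \<in> carleson_box (arc a h) h"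
  proof (cases "z = 0")
    case True
    have "cis a \<in> arc a h" using assms by (auto simp: arc_def)
    thus ?thesis using True z by (auto simp: carleson_box_def intro!: exI[of _ 0] exI[of _ a])
  next
    case False
    hence 1: "z / of_real (norm z) \<in> arc a h" using z by auto
    then obtain \<phi> where "z / of_real (norm z) = cis \<phi>" by (auto simp: arc_def)
    hence "z = of_real (norm z) * cis \<phi>" "cis \<phi> \<in> arc a h"
      using False 1 by (simp add: divide_eq_eq mult.commute, metis)
    thus ?thesis using z unfolding carleson_box_def by (intro CollectI exI[of _ "norm z"] exI[of _ \<phi>]) auto
  qed
qed

lemma carleson_box_borel: 
  assumes "0 < h"
  shows "carleson_box (arc a h) h \<in> sets borel"
proof -
  have "compact (arc a h)" unfolding arc_def
    by (intro compact_continuous_image continuous_intros) auto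
  hence [measurable]: "arc a h \<in> sets borel" by (simp add: borel_compact)
  show ?thesis unfolding carleson_box_arc_eq[OF assms] by measurable
qed

lemma carleson_box_full: "ball 0 1 \<subseteq> carleson_box (arc 0 (2*pi)) (2*pi)"
proof
  fix z :: complex assume z: "z \<in> ball 0 1"
  have "0 \<le> Arg2pi z \<and> Arg2pi z < 2*pi" "z = of_real (norm z) * cis (Arg2pi z)"
    using Arg2pi[of z] by (auto simp: is_Arg_def cis_conv_exp)
  moreover have "1 - 2*pi < norm z" using pi_gt3 norm_ge_zero[of z] by linarith
  ultimately show "z \<in> carleson_box (arc 0 (2*pi)) (2*pi)"
    using z unfolding carleson_box_def arc_def
    by (intro CollectI exI[of _ "norm z"] exI[of _ "Arg2pi z"]) auto
qed


text \<open>The disk fits into the box over the arc centred at the direction of \<open>z\<close>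
  with length \<open>h\<close> proportional to \<open>1 - norm z\<close>. If that \<open>h\<close>
  exceeds a full turn, the box of the whole circle contains the disk and has a smaller
  bound.\<close>

lemma emeasure_ball_le_of_carleson:
  fixes \<mu> :: "complex measure"
  assumes sets: "sets \<mu> = sets borel" and R: "R > 0" and a2: "\<alpha> > -2"
    and carl: "\<And>a h. 0 < h \<Longrightarrow> h \<le> 2*pi \<Longrightarrow> emeasure \<mu> (carleson_box (arc a h) h) \<le> ennreal (C * h powr (\<alpha> + 2))"
    and C: "C > 0" and z: "norm z < 1"
  shows "emeasure \<mu> (ball z (R * (1 - norm z)) \<inter> ball 0 1)
           \<le> ennreal (C * (4 * pi * (R + 1)) powr (\<alpha> + 2) * (1 - norm z) powr (\<alpha> + 2))"
proof -
  define d where "d = 1 - norm z"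
  \<comment> \<open>Radially the disk reaches depth \<open>(R + 1) * d\<close>. Angularly,
    \<open>norm z \<ge> 1/2\<close> and the chord estimate confine it to
    \<open>2 * pi * R * d\<close> on either side, which is at most \<open>h / 2\<close>.\<close>
  define h where "h = 4 * pi * (R + 1) * d"
  have d: "0 < d" "d \<le> 1" using z by (auto simp: d_def)
  have h: "0 < h" using d R by (simp add: h_def)
  have eq: "C * (4 * pi * (R + 1)) powr (\<alpha> + 2) * d powr (\<alpha> + 2) = C * h powr (\<alpha> + 2)"
    using d R by (simp add: h_def powr_mult)
  show ?thesis
  proof (cases "h \<le> 2 * pi")
    case False
    have "emeasure \<mu> (ball z (R * d) \<inter> ball 0 1) \<le> emeasure \<mu> (carleson_box (arc 0 (2*pi)) (2*pi))"
      using carleson_box_full by (intro emeasure_mono) (auto simp: sets carleson_box_borel)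
    also have "\<dots> \<le> ennreal (C * (2*pi) powr (\<alpha> + 2))" by (rule carl) auto
    also have "\<dots> \<le> ennreal (C * h powr (\<alpha> + 2))"
      using False C a2 by (intro ennreal_leI mult_left_mono powr_mono2) auto
    finally show ?thesis by (simp add: eq flip: d_def)
  next
    case True
    have small: "(R + 1) * d \<le> 1/2" using True pi_gt_zero
      mult_le_cancel_left_pos[of "4 * pi" "(R + 1) * d" "1/2"] by (simp add: h_def mult.assoc)
    hence Rd: "R * d \<le> 1/2" "d \<le> 1/2" using mult_pos_pos[OF R d(1)] R d unfolding distrib_right by linarith+
    obtain a where a: "z = of_real (norm z) * cis a"
      using Arg2pi[of z] by (auto simp: is_Arg_def cis_conv_exp)
    have "ball z (R * d) \<inter> ball 0 1 \<subseteq> carleson_box (arc (a - h/2) h) h"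
    proof
      fix w assume "w \<in> ball z (R * d) \<inter> ball 0 1"
      hence w: "norm (w - z) < R * d" "norm w < 1" by (auto simp: dist_norm norm_minus_commute)
      define b where "b = Arg (w / cis a)"
      have b: "\<bar>b\<bar> \<le> pi" "w = of_real (norm w) * cis (a + b)"
      proof -
        show "\<bar>b\<bar> \<le> pi" using Arg_bounded[of "w / cis a"] by (auto simp: b_def)
        have "w / cis a = of_real (norm w) * cis b"
          using Arg_eq[of "w / cis a"] by (cases "w = 0") (auto simp: b_def cis_conv_exp norm_divide)
        thus "w = of_real (norm w) * cis (a + b)" by (simp add: field_simps flip: cis_mult)
      qed
      have nz: "norm z \<ge> 1/2" using Rd by (simp add: d_def)
      \<comment> \<open>To compare directions, \<open>w\<close> is moved radially to the modulus of
        \<open>z\<close>; this costs a second \<open>norm (w - z)\<close> and hence the factor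
        2.\<close>
      have "norm z * norm (cis (a + b) - cis a) = norm (of_real (norm z) * cis (a + b) - z)"
        by (subst (3) a) (simp add: norm_mult flip: right_diff_distrib)
      also have "\<dots> = norm ((w - z) - of_real (norm w - norm z) * cis (a + b))"
        using arg_cong[OF b(2), of "\<lambda>u. norm (of_real (norm z) * cis (a + b) - z + w - u)"]
        by (simp add: algebra_simps)
      also have "\<dots> \<le> norm (w - z) + \<bar>norm w - norm z\<bar>"
        using norm_triangle_ineq4[of "w - z" "of_real (norm w - norm z) * cis (a + b)"]
        by (simp only: norm_mult norm_of_real norm_cis mult_1_right)
      also have "\<dots> \<le> 2 * norm (w - z)" using norm_triangle_ineq3[of w z] by simp
      also have "\<dots> \<le> 2 * (R * d)" using w by simp
      finally have 1: "norm z * norm (cis (a + b) - cis a) \<le> 2 * (R * d)" .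
      have "1/2 * (2/pi * \<bar>b\<bar>) \<le> norm z * norm (cis (a + b) - cis a)"
        using norm_cis_diff_ge[of "a+b" a] b(1) nz by (intro mult_mono) auto
      with 1 have "\<bar>b\<bar> / pi \<le> 2 * (R * d)" by simp
      hence "\<bar>b\<bar> \<le> 2 * pi * (R * d)" by (simp add: divide_le_eq ac_simps)
      also have "\<dots> \<le> h / 2" using d by (simp add: h_def algebra_simps)
      finally have bh: "\<bar>b\<bar> \<le> h / 2" .
      have "1 - norm w \<le> d + norm (w - z)" using norm_triangle_ineq3[of w z] by (simp add: d_def)
      also have "\<dots> < (R + 1) * d" using w by (simp add: algebra_simps)
      also have "\<dots> \<le> (4 * pi) * ((R + 1) * d)"
        using R d pi_gt3 by (intro mult_right_mono[of 1 "4*pi", simplified]) auto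
      finally have "1 - norm w < h" by (simp add: h_def algebra_simps)
      moreover have "cis (a + b) \<in> arc (a - h/2) h"
        unfolding arc_def using bh by (intro imageI) (auto simp: abs_le_iff)
      ultimately show "w \<in> carleson_box (arc (a - h/2) h) h"
        using b(2) w(2) unfolding carleson_box_def
        by (intro CollectI exI[of _ "norm w"] exI[of _ "a + b"]) auto
    qed
    hence "emeasure \<mu> (ball z (R * d) \<inter> ball 0 1) \<le> emeasure \<mu> (carleson_box (arc (a - h/2) h) h)"
      using h by (intro emeasure_mono) (auto simp: sets carleson_box_borel)
    also have "\<dots> \<le> ennreal (C * h powr (\<alpha> + 2))" using h True by (intro carl)
    finally show ?thesis by (simp add: eq flip: d_def)
  qed
qed

text \<open>The first power with \<open>\<rho> ^ n * H < u\<close> exists because the powers tend to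
  0, and it is not the zeroth because \<open>u \<le> H\<close>. This serves the layers of radii, of
  the size of \<open>1 - cnj z * w\<close>, and of arc densities.\<close>

lemma ex_geometric_layer:
  fixes u H \<rho> :: real
  assumes "0 < u" "u \<le> H" "0 < \<rho>" "\<rho> < 1"
  obtains k where "\<rho> ^ Suc k * H < u" "u \<le> \<rho> ^ k * H"
proof -
  have "(\<lambda>k. \<rho> ^ k * H) \<longlonglongrightarrow> 0 * H"
    using assms by (intro tendsto_intros LIMSEQ_power_zero) auto
  hence "eventually (\<lambda>k. \<rho> ^ k * H < u) sequentially"
    using assms by (intro order_tendstoD(2)[of _ 0]) auto
  then obtain n where n: "\<rho> ^ n * H < u" by (auto simp: eventually_sequentially)
  define m where "m = (LEAST n. \<rho> ^ n * H < u)"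
  have m: "\<rho> ^ m * H < u" unfolding m_def using n by (rule LeastI)
  have "m \<noteq> 0" using m assms(2) by (metis mult_1 not_less power_0)
  then obtain k where k: "m = Suc k" by (cases m) auto
  hence "\<not> \<rho> ^ k * H < u" using not_less_Least[of k "\<lambda>n. \<rho> ^ n * H < u"] by (simp add: m_def)
  thus ?thesis using that m k by auto
qed

lemma power_powr_commute:
  fixes x b :: real
  assumes "0 \<le> x"
  shows "(x ^ k) powr b = (x powr b) ^ k"
  using assms by (induction k) (simp_all add: powr_mult)

text \<open>Layer \<open>k\<close>, at distance about \<open>s k\<close> from the circle, takes
  about \<open>h / s k\<close> disks of mass at most a constant times
  \<open>s k powr (\<alpha> + 2)\<close>. The layer sums behave like
  \<open>s k powr (\<alpha> + 1)\<close>, geometric exactly because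
  \<open>\<alpha> > -1\<close>.\<close>

lemma carleson_box_le_of_ball_le:
  fixes \<mu> :: "complex measure"
  assumes sets: "sets \<mu> = sets borel" and eps: "0 < \<epsilon>" "\<epsilon> \<le> 1" and al: "\<alpha> > -1" and C: "C > 0"
    and ball: "\<And>z. norm z < 1 \<Longrightarrow> emeasure \<mu> (ball z (\<epsilon> * (1 - norm z))) \<le> ennreal (C * (1 - norm z) powr (\<alpha> + 2))"
  shows "\<exists>C'>0. \<forall>a h. 0 < h \<and> h \<le> 2*pi \<longrightarrow>
           emeasure \<mu> (carleson_box (arc a h) h) \<le> ennreal (C' * h powr (\<alpha> + 2))"
proof -
  \<comment> \<open>With this ratio a layer has thickness \<open>\<epsilon>/2 * s k\<close>.
    Together with the angular mesh \<open>\<epsilon>/4 * s k\<close>, every point is within three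
    quarters of the radius \<open>\<epsilon> * s k\<close> of some centre.\<close>
  define \<rho> where "\<rho> = 1 - \<epsilon>/2"
  have \<rho>: "0 < \<rho>" "\<rho> < 1" using eps by (auto simp: \<rho>_def)
  define x where "x = \<rho> powr (\<alpha> + 1)"
  have x: "0 < x" "x < 1" using \<rho> al powr_less_mono2[of "\<alpha> + 1" \<rho> 1] by (auto simp: x_def)
  define M where "M = C * (8*pi/\<epsilon> + 2)"
  have M: "M > 0" using C eps by (auto simp: M_def intro!: mult_pos_pos add_pos_pos divide_pos_pos)
  have "emeasure \<mu> (carleson_box (arc a h) h) \<le> ennreal (M / (1 - x) * h powr (\<alpha> + 2))"
    if h: "0 < h" "h \<le> 2*pi" for a h
  proof -
    \<comment> \<open>A box with \<open>h > 1\<close> already reaches the origin, so its depth is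
      capped at 1, which keeps the moduli \<open>1 - s k\<close> of the centres nonnegative.
      \<open>h \<le> 2 * pi * H\<close> lets the disk count be expressed through the depth.\<close>
    define H where "H = min h 1"
    have H: "0 < H" "H \<le> 1" "H \<le> h" "h \<le> 2 * pi * H"
      using h pi_gt3 by (auto simp: H_def min_def)
    define s where "s = (\<lambda>k. \<rho> ^ k * H)"
    have s: "0 < s k" "s k \<le> 1" for k
      using \<rho> H by (auto simp: s_def intro!: mult_le_one power_le_one)
    define N where "N = (\<lambda>k. nat \<lfloor>4 * h / (\<epsilon> * s k)\<rfloor>)"
    define c where "c = (\<lambda>k j. of_real (1 - s k) * cis (a + real j * (\<epsilon> * s k / 4)))"
    define B where "B = (\<lambda>k j. ball (c k j) (\<epsilon> * s k))"
    have nc: "norm (c k j) = 1 - s k" for k j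
      using s[of k] by (simp only: c_def norm_mult norm_of_real norm_cis) simp
    have cover: "carleson_box (arc a h) h \<subseteq> (\<Union>k. \<Union>j\<le>N k. B k j)"
    proof
      fix z assume "z \<in> carleson_box (arc a h) h"
      then obtain r \<phi> where z: "z = of_real r * cis \<phi>" "0 \<le> r" "1 - h < r" "r < 1" "\<phi> \<in> {a..a+h}"
        unfolding carleson_box_def arc_def by auto
      have "0 < 1 - r" "1 - r \<le> H" using z by (auto simp: H_def)
      then obtain k where k: "\<rho> ^ Suc k * H < 1 - r" "1 - r \<le> s k"
        using ex_geometric_layer[OF _ _ \<rho>] unfolding s_def by metis
      define e where "e = \<epsilon> * s k / 4"
      have e: "e > 0" using eps s[of k] by (simp add: e_def)
      define j where "j = nat \<lfloor>(\<phi> - a) / e\<rfloor>"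
      have rj: "real j = of_int \<lfloor>(\<phi> - a) / e\<rfloor>" using z(5) e by (simp add: j_def)
      have "real j \<le> (\<phi> - a) / e" "(\<phi> - a) / e < real j + 1"
        unfolding rj by linarith+
      hence j1: "real j * e \<le> \<phi> - a" "\<phi> - a < (real j + 1) * e"
        using e by (simp_all add: le_divide_eq divide_less_eq)
      have "j \<le> N k"
      proof -
        have "(\<phi> - a) / e \<le> h / e" using z(5) e by (intro divide_right_mono) auto
        also have "h / e = 4 * h / (\<epsilon> * s k)" by (simp add: e_def)
        finally show ?thesis unfolding j_def N_def by (intro nat_mono floor_mono)
      qed
      moreover have "norm (z - c k j) < \<epsilon> * s k"
      proof -
        have "z - c k j = of_real (r - (1 - s k)) * cis \<phi> + of_real (1 - s k) * (cis \<phi> - cis (a + real j * e))"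
          by (simp add: z(1) c_def e_def algebra_simps)
        hence "norm (z - c k j) \<le> norm (of_real (r - (1 - s k)) * cis \<phi>) + norm (of_real (1 - s k) * (cis \<phi> - cis (a + real j * e)))"
          by (metis norm_triangle_ineq)
        also have "norm (of_real (r - (1 - s k)) * cis \<phi>) = \<bar>r - (1 - s k)\<bar>"
          by (simp only: norm_mult norm_of_real norm_cis) simp
        also have "\<dots> \<le> \<epsilon> / 2 * s k"
        proof -
          have "\<rho> ^ Suc k * H = s k - \<epsilon>/2 * s k" by (simp add: s_def \<rho>_def algebra_simps)
          thus ?thesis using k by auto
        qed
        also have "norm (of_real (1 - s k) * (cis \<phi> - cis (a + real j * e))) \<le> 1 * \<bar>\<phi> - (a + real j * e)\<bar>"
          unfolding norm_mult norm_of_real using s[of k] by (intro mult_mono norm_cis_diff_le) auto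
        also have "\<dots> \<le> e" using j1 by (auto simp: algebra_simps)
        finally have "norm (z - c k j) \<le> 3/4 * (\<epsilon> * s k)" by (simp add: e_def)
        moreover have "0 < \<epsilon> * s k" using eps s[of k] by simp
        ultimately show ?thesis by linarith
      qed
      ultimately show "z \<in> (\<Union>k. \<Union>j\<le>N k. B k j)"
        by (intro UN_I[of k] UN_I[of j]) (simp_all add: B_def dist_norm norm_minus_commute)
    qed
    have layer: "(\<Sum>j\<le>N k. emeasure \<mu> (B k j)) \<le> ennreal (M * H powr (\<alpha>+2) * x ^ k)" for k
    proof -
      have "(\<Sum>j\<le>N k. emeasure \<mu> (B k j)) \<le> (\<Sum>j\<le>N k. ennreal (C * s k powr (\<alpha> + 2)))"
      proof (rule sum_mono)
        fix j
        show "emeasure \<mu> (B k j) \<le> ennreal (C * s k powr (\<alpha> + 2))"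
          using ball[of "c k j"] s[of k] by (simp add: B_def nc)
      qed
      also have "\<dots> = ennreal ((real (N k) + 1) * (C * s k powr (\<alpha> + 2)))"
        using C by (simp add: ennreal_mult' add.commute flip: ennreal_of_nat_eq_real_of_nat)
      also have "\<dots> \<le> ennreal (M * H powr (\<alpha>+2) * x ^ k)"
      proof (rule ennreal_leI)
        have sk: "s k powr (\<alpha> + 2) = x ^ k * \<rho> ^ k * H powr (\<alpha> + 2)"
        proof -
          have 1: "(\<rho> ^ k) powr (\<alpha> + 2) = (\<rho> ^ k) powr (\<alpha> + 1) * (\<rho> ^ k) powr 1"
            using powr_add[of "\<rho> ^ k" "\<alpha> + 1" 1] by (simp only: add.assoc one_add_one)
          have 2: "(\<rho> ^ k) powr (\<alpha> + 1) = x ^ k"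
            unfolding x_def by (rule power_powr_commute) (use \<rho>(1) in linarith)
          have 3: "(\<rho> ^ k) powr 1 = \<rho> ^ k"
            using \<rho>(1) by (intro powr_one zero_le_power) linarith
          have 4: "s k powr (\<alpha> + 2) = (\<rho> ^ k) powr (\<alpha> + 2) * H powr (\<alpha> + 2)"
            unfolding s_def by (rule powr_mult)
          show ?thesis by (simp only: 1 2 3 4)
        qed
        have "real (N k) \<le> 4 * h / (\<epsilon> * s k)"
          using h eps s[of k] by (auto simp: N_def)
        also have "\<dots> \<le> 4 * (2 * pi * H) / (\<epsilon> * s k)"
          using H eps s[of k] by (intro divide_right_mono mult_left_mono) auto
        also have "\<dots> = 8 * pi / \<epsilon> / \<rho> ^ k" using H by (simp add: s_def)
        finally have Nk: "real (N k) \<le> 8 * pi / \<epsilon> / \<rho> ^ k" .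
        define p where "p = \<rho> ^ k"
        define Q where "Q = 8 * pi / \<epsilon>"
        define Y where "Y = H powr (\<alpha>+2)"
        have p: "0 < p" "p \<le> 1" using \<rho> by (simp_all add: p_def power_le_one)
        \<comment> \<open>Absorbs the extra centre: the index \<open>j\<close> runs from 0, so a
          layer has \<open>N k + 1\<close> centres.\<close>
        have "1 \<le> 2 / p" unfolding le_divide_eq using p by simp
        hence "real (N k) + 1 \<le> Q / p + 2 / p" using Nk by (intro add_mono) (simp_all only: p_def Q_def)
        hence "real (N k) + 1 \<le> (Q + 2) / p" by (simp only: add_divide_distrib)
        moreover have "0 \<le> C * (x ^ k * p * Y)" using C x p by (simp add: Y_def)
        ultimately have "(real (N k) + 1) * (C * (x ^ k * p * Y)) \<le> (Q + 2) / p * (C * (x ^ k * p * Y))"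
          by (rule mult_right_mono)
        also have "\<dots> = C * (Q + 2) * Y * x ^ k" using p(1) by simp
        finally show "(real (N k) + 1) * (C * s k powr (\<alpha> + 2)) \<le> M * H powr (\<alpha>+2) * x ^ k"
          unfolding sk M_def p_def[symmetric] Q_def[symmetric] Y_def[symmetric] .
      qed
      finally show ?thesis .
    qed
    have "emeasure \<mu> (carleson_box (arc a h) h) \<le> emeasure \<mu> (\<Union>k. \<Union>j\<le>N k. B k j)"
      by (rule emeasure_mono[OF cover]) (auto simp: sets B_def)
    also have "\<dots> \<le> (\<Sum>k. emeasure \<mu> (\<Union>j\<le>N k. B k j))"
      by (rule emeasure_subadditive_countably) (auto simp: sets B_def)
    also have "\<dots> \<le> (\<Sum>k. \<Sum>j\<le>N k. emeasure \<mu> (B k j))"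
      by (intro suminf_le emeasure_subadditive_finite) (auto simp: sets B_def)
    also have "\<dots> \<le> (\<Sum>k. ennreal (M * H powr (\<alpha>+2) * x ^ k))"
      by (intro suminf_le layer) auto
    also have "\<dots> = ennreal (M * H powr (\<alpha>+2) / (1 - x))"
      using M x by (intro suminf_ennreal_geometric) auto
    also have "\<dots> \<le> ennreal (M / (1 - x) * h powr (\<alpha> + 2))"
    proof (rule ennreal_leI)
      have "M / (1 - x) * H powr (\<alpha>+2) \<le> M / (1 - x) * h powr (\<alpha> + 2)"
        using M x H al by (intro mult_left_mono powr_mono2) auto
      thus "M * H powr (\<alpha>+2) / (1 - x) \<le> M / (1 - x) * h powr (\<alpha> + 2)" by simp
    qed
    finally show ?thesis .
  qed
  thus ?thesis using M x by (intro exI[of _ "M / (1 - x)"]) auto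
qed

section \<open>Cone integrals of a test function\<close>

lemma lusin_cone_iff:
  assumes "\<xi> \<in> sphere 0 1"
  shows "z \<in> lusin_cone \<sigma> \<xi> \<longleftrightarrow> norm z < 1 \<and> norm (\<xi> - z) < \<sigma> * (1 - norm z)"
proof -
  have "cnj \<xi> * \<xi> = 1"
    using assms complex_norm_square[of \<xi>] by (simp add: mult.commute)
  hence "1 - cnj \<xi> * z = cnj \<xi> * (\<xi> - z)" by (simp add: right_diff_distrib)
  hence "norm (1 - cnj \<xi> * z) = norm (\<xi> - z)" using assms by (simp add: norm_mult)
  thus ?thesis by (simp add: lusin_cone_def)
qed

lemma lusin_cone_borel [measurable]: "lusin_cone \<sigma> \<xi> \<in> sets borel"
  unfolding lusin_cone_def by measurable

lemma ball_complex_borel [measurable]: "ball (c::complex) r \<in> sets borel"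
  by simp

lemma sets_area_measure [simp, measurable_cong]: "sets area_measure = sets borel"
  by (simp add: area_measure_def)

lemma area_measure_ball_le:
  assumes "r \<ge> 0"
  shows "emeasure area_measure (ball c r) \<le> ennreal (r\<^sup>2)"
proof -
  have "emeasure area_measure (ball c r) = (\<integral>\<^sup>+z. ennreal (1/pi) * indicator (ball 0 1) z * indicator (ball c r) z \<partial>lborel)"
    unfolding area_measure_def
  proof (rule emeasure_density)
    have [measurable]: "ball 0 1 \<in> sets (lborel :: complex measure)" by simp
    show "(\<lambda>z::complex. ennreal (1/pi) * indicator (ball 0 1) z) \<in> borel_measurable lborel"
      by (rule borel_measurable_times_ennreal) (auto intro!: borel_measurable_indicator)
  qed simp
  also have "\<dots> \<le> (\<integral>\<^sup>+z. ennreal (1/pi) * indicator (ball c r) z \<partial>lborel)"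
    by (intro nn_integral_mono) (auto simp: indicator_def)
  also have "\<dots> = ennreal (1/pi) * emeasure lborel (ball c r)"
    by (subst nn_integral_cmult_indicator) auto
  also have "\<dots> = ennreal (r\<^sup>2)"
    using assms by (simp add: emeasure_ball unit_ball_vol_2 flip: ennreal_mult)
  finally show ?thesis .
qed

lemma ennreal_term_le_suminf: "f k \<le> (\<Sum>k. f k)" for f :: "nat \<Rightarrow> ennreal"
  using sum_le_suminf[of f "{k}"] by simp

text \<open>One constant for both signs of the exponent, because \<open>\<alpha> - 1\<close> may be
  negative or positive.\<close>

lemma powr_le_of_half_layer:
  fixes u v :: real
  assumes "v / 2 < u" "u \<le> v" "v > 0"
  shows "u powr p \<le> 2 powr \<bar>p\<bar> * v powr p"
proof (cases "p \<ge> 0")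
  case True
  have "u powr p \<le> v powr p" using assms True by (intro powr_mono2) auto
  also have "\<dots> \<le> 2 powr \<bar>p\<bar> * v powr p"
    using ge_one_powr_ge_zero[of 2 "\<bar>p\<bar>"] mult_right_mono[of 1 "2 powr \<bar>p\<bar>" "v powr p"] by simp
  finally show ?thesis .
next
  case False
  have "u powr p \<le> (v/2) powr p" using assms False by (intro powr_mono2') auto
  also have "\<dots> = 2 powr \<bar>p\<bar> * v powr p"
  proof -
    have "(v/2) powr p = v powr p * 2 powr (- p)"
      using assms powr_divide[of v 2 p] powr_minus_divide[of 2 p] by simp
    thus ?thesis using False by (simp add: mult.commute)
  qed
  finally show ?thesis .
qed

text \<open>The part of the cone with \<open>1 - norm w\<close> about \<open>v k\<close> lies in the
  ball about the vertex of radius \<open>\<sigma> * v k\<close>, whose area is of order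
  \<open>v k\<close> squared. It contributes about \<open>v k powr (\<alpha> + 1)\<close>, and these
  terms sum geometrically from the top layer \<open>s\<close>.\<close>

lemma truncated_cone_integral_le:
  assumes al: "\<alpha> > -1" and sig: "\<sigma> > 0"
  shows "\<exists>K>0. \<forall>\<xi>\<in>sphere 0 1. \<forall>s>0.
    (\<integral>\<^sup>+w. indicator (lusin_cone \<sigma> \<xi> \<inter> {w. 1 - norm w \<le> s}) w * ennreal ((1 - norm w) powr (\<alpha> - 1)) \<partial>area_measure)
      \<le> ennreal (K * s powr (\<alpha> + 1))"
proof -
  define x where "x = (1/2) powr (\<alpha> + 1)"
  have x: "0 < x" "x < 1" using al powr_less_mono2[of "\<alpha> + 1" "1/2" 1] by (auto simp: x_def)
  define c where "c = 2 powr \<bar>\<alpha> - 1\<bar>"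
  have c: "c > 0" by (simp add: c_def)
  define K where "K = c * \<sigma>\<^sup>2 / (1 - x)"
  have "(\<integral>\<^sup>+w. indicator (lusin_cone \<sigma> \<xi> \<inter> {w. 1 - norm w \<le> s}) w * ennreal ((1 - norm w) powr (\<alpha> - 1)) \<partial>area_measure)
      \<le> ennreal (K * s powr (\<alpha> + 1))" if xi: "\<xi> \<in> sphere 0 1" and s: "s > 0" for \<xi> s
  proof -
    define v where "v = (\<lambda>k. (1/2)^k * s)"
    have v: "v k > 0" for k using s by (simp add: v_def)
    have "(\<integral>\<^sup>+w. indicator (lusin_cone \<sigma> \<xi> \<inter> {w. 1 - norm w \<le> s}) w * ennreal ((1 - norm w) powr (\<alpha> - 1)) \<partial>area_measure)
       \<le> (\<integral>\<^sup>+w. (\<Sum>k. ennreal (c * v k powr (\<alpha> - 1)) * indicator (ball \<xi> (\<sigma> * v k)) w) \<partial>area_measure)"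
    proof (rule nn_integral_mono)
      fix w
      show "indicator (lusin_cone \<sigma> \<xi> \<inter> {w. 1 - norm w \<le> s}) w * ennreal ((1 - norm w) powr (\<alpha> - 1))
        \<le> (\<Sum>k. ennreal (c * v k powr (\<alpha> - 1)) * indicator (ball \<xi> (\<sigma> * v k)) w)"
      proof (cases "w \<in> lusin_cone \<sigma> \<xi> \<and> 1 - norm w \<le> s")
        case True
        hence w: "norm w < 1" "norm (\<xi> - w) < \<sigma> * (1 - norm w)" "1 - norm w \<le> s"
          using lusin_cone_iff[OF xi] by auto
        have "0 < 1 - norm w" using w by simp
        from ex_geometric_layer[OF this w(3), of "1/2"]
        obtain k where k: "v (Suc k) < 1 - norm w" "1 - norm w \<le> v k"
          unfolding v_def by auto
        have "\<sigma> * (1 - norm w) \<le> \<sigma> * v k" using k sig by (intro mult_left_mono) auto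
        hence in_ball: "w \<in> ball \<xi> (\<sigma> * v k)" using w by (simp add: dist_norm)
        have "(1 - norm w) powr (\<alpha> - 1) \<le> c * v k powr (\<alpha> - 1)"
          unfolding c_def using k v[of k] by (intro powr_le_of_half_layer) (auto simp: v_def)
        hence "ennreal ((1 - norm w) powr (\<alpha> - 1)) \<le> ennreal (c * v k powr (\<alpha> - 1)) * indicator (ball \<xi> (\<sigma> * v k)) w"
          using in_ball by (simp add: ennreal_leI)
        also have "\<dots> \<le> (\<Sum>k. ennreal (c * v k powr (\<alpha> - 1)) * indicator (ball \<xi> (\<sigma> * v k)) w)"
          by (rule ennreal_term_le_suminf)
        finally show ?thesis using True by simp
      qed auto
    qed
    also have "\<dots> = (\<Sum>k. \<integral>\<^sup>+w. ennreal (c * v k powr (\<alpha> - 1)) * indicator (ball \<xi> (\<sigma> * v k)) w \<partial>area_measure)"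
      by (rule nn_integral_suminf) measurable
    also have "\<dots> \<le> (\<Sum>k. ennreal (c * \<sigma>\<^sup>2 * s powr (\<alpha> + 1) * x ^ k))"
    proof (intro suminf_le)
      fix k
      have "(\<integral>\<^sup>+w. ennreal (c * v k powr (\<alpha> - 1)) * indicator (ball \<xi> (\<sigma> * v k)) w \<partial>area_measure)
         = ennreal (c * v k powr (\<alpha> - 1)) * emeasure area_measure (ball \<xi> (\<sigma> * v k))"
        by (subst nn_integral_cmult_indicator) auto
      also have "\<dots> \<le> ennreal (c * v k powr (\<alpha> - 1)) * ennreal ((\<sigma> * v k)\<^sup>2)"
        using v[of k] sig by (intro mult_left_mono area_measure_ball_le) auto
      also have "\<dots> = ennreal (c * v k powr (\<alpha> - 1) * (\<sigma> * v k)\<^sup>2)"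
        using c by (simp add: ennreal_mult)
      also have "c * v k powr (\<alpha> - 1) * (\<sigma> * v k)\<^sup>2 = c * \<sigma>\<^sup>2 * s powr (\<alpha> + 1) * x ^ k"
      proof -
        have 1: "v k powr (\<alpha> - 1) * (v k)\<^sup>2 = v k powr (\<alpha> + 1)"
          using powr_add[of "v k" "\<alpha> - 1" 2] v[of k] by (simp add: add.commute)
        have 2: "v k powr (\<alpha> + 1) = x ^ k * s powr (\<alpha> + 1)"
          unfolding v_def powr_mult by (simp only: power_powr_commute x_def)
        have "c * v k powr (\<alpha> - 1) * (\<sigma> * v k)\<^sup>2 = c * \<sigma>\<^sup>2 * (v k powr (\<alpha> - 1) * (v k)\<^sup>2)"
          by (simp only: power_mult_distrib ac_simps)
        thus ?thesis unfolding 1 2 by (simp only: ac_simps)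
      qed
      finally show "(\<integral>\<^sup>+w. ennreal (c * v k powr (\<alpha> - 1)) * indicator (ball \<xi> (\<sigma> * v k)) w \<partial>area_measure)
         \<le> ennreal (c * \<sigma>\<^sup>2 * s powr (\<alpha> + 1) * x ^ k)" .
    qed auto
    also have "\<dots> = ennreal (c * \<sigma>\<^sup>2 * s powr (\<alpha> + 1) / (1 - x))"
      using c x by (intro suminf_ennreal_geometric) auto
    finally show ?thesis by (simp add: K_def)
  qed
  moreover have "K > 0" using c x sig by (simp add: K_def)
  ultimately show ?thesis by blast
qed

text \<open>On the cone, \<open>u = norm (1 - cnj z * w)\<close> dominates both
  \<open>1 - norm w\<close> and \<open>norm (\<xi> - z) / (1 + \<sigma>)\<close>. Splitting by
  \<open>u\<close> about \<open>2 ^ k * e\<close>, each piece lies in a truncated cone of height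
  \<open>2 * v k\<close> and contributes about \<open>v k powr (\<alpha> + 1 - n)\<close>, that is
  \<open>v k powr (- m)\<close>. As \<open>m > 0\<close>, the smallest scale decides.\<close>

lemma cone_integral_test_function_le:
  assumes al: "\<alpha> > -1" and sig: "\<sigma> > 1" and m: "real n = m + \<alpha> + 1" "m > 0"
  shows "\<exists>K>0. \<forall>\<xi>\<in>sphere 0 1. \<forall>z\<in>ball 0 1.
    (\<integral>\<^sup>+w. indicator (lusin_cone \<sigma> \<xi>) w * ennreal (norm (1 / (1 - cnj z * w) ^ n) * (1 - norm w) powr (\<alpha> - 1)) \<partial>area_measure)
      \<le> ennreal (K * norm (\<xi> - z) powr (- m))"
proof -
  obtain K1 where K1: "K1 > 0" "\<And>\<xi> s. \<xi> \<in> sphere 0 1 \<Longrightarrow> s > 0 \<Longrightarrow>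
    (\<integral>\<^sup>+w. indicator (lusin_cone \<sigma> \<xi> \<inter> {w. 1 - norm w \<le> s}) w * ennreal ((1 - norm w) powr (\<alpha> - 1)) \<partial>area_measure)
      \<le> ennreal (K1 * s powr (\<alpha> + 1))"
    using truncated_cone_integral_le[OF al, of \<sigma>] sig by auto
  define x where "x = 2 powr (- m)"
  have x: "0 < x" "x < 1" using m powr_less_mono[of "-m" 0 2] by (auto simp: x_def)
  define K where "K = K1 * 2 powr (\<alpha> + 1) * (1 + \<sigma>) powr m / (1 - x)"
  have "(\<integral>\<^sup>+w. indicator (lusin_cone \<sigma> \<xi>) w * ennreal (norm (1 / (1 - cnj z * w) ^ n) * (1 - norm w) powr (\<alpha> - 1)) \<partial>area_measure)
      \<le> ennreal (K * norm (\<xi> - z) powr (- m))" if xi: "\<xi> \<in> sphere 0 1" and z: "z \<in> ball 0 1" for \<xi> z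
  proof -
    define d where "d = norm (\<xi> - z)"
    have d: "d > 0" using xi z by (auto simp: d_def)
    define e where "e = d / (1 + \<sigma>)"
    have e: "e > 0" using d sig by (simp add: e_def)
    have nxz: "norm (1 - cnj z * \<xi>) = d"
    proof -
      have "norm (1 - cnj z * \<xi>) = norm (1 - cnj \<xi> * z)"
        using complex_mod_cnj[of "1 - cnj z * \<xi>"] by (simp add: mult.commute)
      also have "cnj \<xi> * \<xi> = 1"
        using xi complex_norm_square[of \<xi>] by (simp add: mult.commute)
      hence "1 - cnj \<xi> * z = cnj \<xi> * (\<xi> - z)" by (simp add: right_diff_distrib)
      hence "norm (1 - cnj \<xi> * z) = d" using xi by (simp add: norm_mult d_def)
      finally show ?thesis .
    qed
    define v where "v = (\<lambda>k. 2 ^ k * e)"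
    have v: "v k > 0" for k using e by (simp add: v_def)
    let ?T = "\<lambda>k w. indicator (lusin_cone \<sigma> \<xi> \<inter> {w. 1 - norm w \<le> 2 * v k}) w * ennreal ((1 - norm w) powr (\<alpha> - 1))"
    have "(\<integral>\<^sup>+w. indicator (lusin_cone \<sigma> \<xi>) w * ennreal (norm (1 / (1 - cnj z * w) ^ n) * (1 - norm w) powr (\<alpha> - 1)) \<partial>area_measure)
       \<le> (\<integral>\<^sup>+w. (\<Sum>k. ennreal (v k powr (- real n)) * ?T k w) \<partial>area_measure)"
    proof (rule nn_integral_mono)
      fix w
      show "indicator (lusin_cone \<sigma> \<xi>) w * ennreal (norm (1 / (1 - cnj z * w) ^ n) * (1 - norm w) powr (\<alpha> - 1))
         \<le> (\<Sum>k. ennreal (v k powr (- real n)) * ?T k w)"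
      proof (cases "w \<in> lusin_cone \<sigma> \<xi>")
        case True
        hence w: "norm w < 1" "norm (\<xi> - w) < \<sigma> * (1 - norm w)"
          using lusin_cone_iff[OF xi] by auto
        define u where "u = norm (1 - cnj z * w)"
        have u1: "1 - norm w \<le> u"
          using norm_one_minus_cnj_ge[of z w] z complex_mod_cnj[of "1 - cnj w * z"]
          by (simp add: u_def mult.commute)
        hence u0: "u > 0" using w by simp
        \<comment> \<open>Replacing \<open>w\<close> by the vertex costs at most \<open>norm (\<xi>
          - w) < \<sigma> * (1 - norm w) \<le> \<sigma> * u\<close>.\<close>
        have "d \<le> u + norm (cnj z * (w - \<xi>))"
          using norm_triangle_ineq[of "1 - cnj z * w" "cnj z * (w - \<xi>)"] nxz
          by (simp add: u_def algebra_simps)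
        also have "norm (cnj z * (w - \<xi>)) \<le> norm (\<xi> - w)"
          using z by (simp add: norm_mult mult_left_le_one_le norm_minus_commute)
        also have "\<dots> \<le> \<sigma> * u"
          using w(2) mult_left_mono[OF u1, of \<sigma>] sig by linarith
        finally have "d \<le> (1 + \<sigma>) * u" by (simp add: algebra_simps)
        hence eu: "e \<le> u" using sig by (simp add: e_def divide_le_eq mult.commute)
        \<comment> \<open>The scales grow from \<open>e\<close>, so the lemma on decreasing layers
          is applied to the reciprocal ratio \<open>e / u\<close>.\<close>
        have "0 < e / u" "e / u \<le> 1" using e u0 eu by (simp_all add: divide_le_eq)
        from ex_geometric_layer[OF this, of "1/2"]
        obtain k where k: "(1/2) ^ Suc k * 1 < e / u" "e / u \<le> (1/2) ^ k * 1" by auto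
        have "u < 2 ^ Suc k * e" using k(1) u0 by (simp add: field_simps)
        hence kv: "u < 2 * v k" by (simp add: v_def)
        have vk: "v k \<le> u" using k(2) u0 by (simp add: v_def field_simps)
        have "norm (1 / (1 - cnj z * w) ^ n) = u powr (- real n)"
          using u0 by (simp add: norm_divide norm_inverse norm_power u_def powr_minus powr_realpow divide_inverse)
        also have "\<dots> \<le> v k powr (- real n)" using vk v[of k] by (intro powr_mono2') auto
        finally have "norm (1 / (1 - cnj z * w) ^ n) * (1 - norm w) powr (\<alpha> - 1) \<le> v k powr (- real n) * (1 - norm w) powr (\<alpha> - 1)"
          by (rule mult_right_mono) simp
        hence "ennreal (norm (1 / (1 - cnj z * w) ^ n) * (1 - norm w) powr (\<alpha> - 1)) \<le> ennreal (v k powr (- real n) * (1 - norm w) powr (\<alpha> - 1))"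
          by (rule ennreal_leI)
        also have "\<dots> = ennreal (v k powr (- real n)) * ?T k w"
          using True u1 kv by (simp add: ennreal_mult)
        also have "\<dots> \<le> (\<Sum>k. ennreal (v k powr (- real n)) * ?T k w)"
          by (rule ennreal_term_le_suminf)
        finally show ?thesis using True by simp
      qed auto
    qed
    also have "\<dots> = (\<Sum>k. \<integral>\<^sup>+w. ennreal (v k powr (- real n)) * ?T k w \<partial>area_measure)"
      by (rule nn_integral_suminf) measurable
    also have "\<dots> \<le> (\<Sum>k. ennreal (K1 * 2 powr (\<alpha> + 1) * e powr (- m) * x ^ k))"
    proof (intro suminf_le)
      fix k
      have "(\<integral>\<^sup>+w. ennreal (v k powr (- real n)) * ?T k w \<partial>area_measure) = ennreal (v k powr (- real n)) * (\<integral>\<^sup>+w. ?T k w \<partial>area_measure)"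
        by (rule nn_integral_cmult) measurable
      also have "\<dots> \<le> ennreal (v k powr (- real n)) * ennreal (K1 * (2 * v k) powr (\<alpha> + 1))"
        using v[of k] by (intro mult_left_mono K1(2) xi) auto
      also have "\<dots> = ennreal (v k powr (- real n) * (K1 * (2 * v k) powr (\<alpha> + 1)))"
        using K1 by (simp add: ennreal_mult)
      also have "v k powr (- real n) * (K1 * (2 * v k) powr (\<alpha> + 1)) = K1 * 2 powr (\<alpha> + 1) * e powr (- m) * x ^ k"
      proof -
        have 1: "v k powr (- real n) * v k powr (\<alpha> + 1) = v k powr (- m)"
          using m by (simp flip: powr_add)
        have 2: "v k powr (- m) = x ^ k * e powr (- m)"
          unfolding v_def powr_mult by (simp only: power_powr_commute x_def)
        have "v k powr (- real n) * (K1 * (2 * v k) powr (\<alpha> + 1)) = K1 * 2 powr (\<alpha> + 1) * (v k powr (- real n) * v k powr (\<alpha> + 1))"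
          by (simp only: powr_mult ac_simps)
        thus ?thesis unfolding 1 2 by (simp only: ac_simps)
      qed
      finally show "(\<integral>\<^sup>+w. ennreal (v k powr (- real n)) * ?T k w \<partial>area_measure) \<le> ennreal (K1 * 2 powr (\<alpha> + 1) * e powr (- m) * x ^ k)" .
    qed auto
    also have "\<dots> = ennreal (K1 * 2 powr (\<alpha> + 1) * e powr (- m) / (1 - x))"
      using K1 x by (intro suminf_ennreal_geometric) auto
    also have "K1 * 2 powr (\<alpha> + 1) * e powr (- m) / (1 - x) = K * d powr (- m)"
    proof -
      have "e powr (- m) = (1 + \<sigma>) powr m * d powr (- m)"
        using d sig powr_divide[of d "1 + \<sigma>" "- m"] powr_minus_divide[of "1 + \<sigma>" m]
        by (simp add: e_def)
      thus ?thesis by (simp add: K_def)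
    qed
    finally show ?thesis by (simp add: d_def)
  qed
  moreover have "K > 0" using K1 x sig by (simp add: K_def)
  ultimately show ?thesis by blast
qed

text \<open>The level set at height \<open>s\<close> lies within distance
  \<open>r = (K/s) powr (1/m)\<close> of \<open>z\<close>, and is empty unless
  \<open>r > 1 - norm z\<close>, since no point of the circle is closer to \<open>z\<close>. The
  product to be bounded is of order \<open>K * r powr (1/q - m)\<close>; as
  \<open>1/q \<le> 1 \<le> m\<close>, it is largest at the smallest admissible
  \<open>r\<close>.\<close>

lemma weak_Lq_norm_le_of_pole:
  assumes q: "q \<ge> 1" and m: "m \<ge> 1" and K: "K > 0" and z: "norm z < 1"
    and g: "\<And>\<xi>. \<xi> \<in> sphere 0 1 \<Longrightarrow> g \<xi> \<le> ennreal (K * norm (\<xi> - z) powr (- m))"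
  shows "weak_Lq_norm q g \<le> ennreal (K * (6 * pi) powr (1/q) * (1 - norm z) powr (1/q - m))"
  unfolding weak_Lq_norm_def
proof (intro SUP_least ennreal_leI)
  fix s :: real assume "s \<in> {0<..}"
  hence s: "s > 0" by simp
  define r where "r = (K / s) powr (1 / m)"
  have r: "r > 0" using K s by (simp add: r_def)
  have rm: "r powr (-m) = s / K" using K s m by (simp add: r_def powr_powr powr_minus divide_inverse)
  let ?S = "{\<xi> \<in> sphere 0 1. ennreal s < g \<xi>}"
  have S: "norm (\<xi> - z) < r" if "\<xi> \<in> ?S" for \<xi>
  proof (rule ccontr)
    assume "\<not> norm (\<xi> - z) < r"
    hence "norm (\<xi> - z) powr (- m) \<le> r powr (- m)" using r m by (intro powr_mono2') auto
    hence "K * norm (\<xi> - z) powr (- m) \<le> K * (s / K)" unfolding rm using K by (intro mult_left_mono) auto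
    hence "g \<xi> \<le> ennreal s" using g[of \<xi>] that K ennreal_leI by (metis (no_types, lifting) mem_Collect_eq nonzero_mult_div_cancel_left order_trans times_divide_eq_right less_irrefl)
    thus False using that by (auto simp: not_less)
  qed
  show "s * measure circle_measure ?S powr (1/q) \<le> K * (6 * pi) powr (1/q) * (1 - norm z) powr (1/q - m)"
  proof (cases "?S = {}")
    case True
    show ?thesis unfolding True using K by simp
  next
    case False
    then obtain \<xi> where xi: "\<xi> \<in> ?S" by blast
    have "1 - norm z \<le> norm (\<xi> - z)" using norm_triangle_ineq2[of \<xi> z] xi by simp
    hence dr: "1 - norm z < r" using S[OF xi] by simp
    have "measure circle_measure ?S \<le> measure circle_measure (ball z r)"
      using S by (intro circle.finite_measure_mono) (auto simp: dist_norm norm_minus_commute)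
    also have "\<dots> \<le> 6 * pi * r"
      using circle_measure_ball_le[OF r, of z] r by (simp add: circle.emeasure_eq_measure)
    finally have "measure circle_measure ?S powr (1/q) \<le> (6 * pi * r) powr (1/q)"
      using q by (intro powr_mono2) auto
    hence "s * measure circle_measure ?S powr (1/q) \<le> s * (6 * pi * r) powr (1/q)"
      using s by simp
    also have "\<dots> = K * (6 * pi) powr (1/q) * r powr (1/q - m)"
    proof -
      have "r powr (1/q - m) = r powr (1/q) * (s / K)" unfolding rm[symmetric] by (simp flip: powr_add)
      thus ?thesis using K by (simp add: powr_mult)
    qed
    also have "\<dots> \<le> K * (6 * pi) powr (1/q) * (1 - norm z) powr (1/q - m)"
    proof -
      have "1/q \<le> 1" using q by simp
      thus ?thesis using K dr m z by (intro mult_left_mono powr_mono2') auto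
    qed
    finally show ?thesis .
  qed
qed

text \<open>The cone condition is a strict inequality, so a point of the cone stays in it when the
  vertex moves slightly. Fatou's lemma then makes the cone integral lower semicontinuous on the
  circle, and sublevel sets are closed. The argument works for an arbitrary Borel measure,
  sigma-finite or not.\<close>

lemma cone_superlevel_borel:
  fixes \<mu> :: "complex measure" and h :: "complex \<Rightarrow> ennreal"
  assumes sets: "sets \<mu> = sets borel" and h: "h \<in> borel_measurable borel"
  shows "{\<xi> \<in> sphere 0 1. s < (\<integral>\<^sup>+z. indicator (lusin_cone \<sigma> \<xi>) z * h z \<partial>\<mu>)} \<in> sets borel"
proof -
  note [measurable] = h
  have m: "f \<in> borel_measurable \<mu>" if "f \<in> borel_measurable borel" for f :: "complex \<Rightarrow> ennreal"
    using that measurable_cong_sets[OF sets refl] by blast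
  let ?g = "\<lambda>\<xi>. \<integral>\<^sup>+z. indicator (lusin_cone \<sigma> \<xi>) z * h z \<partial>\<mu>"
  have "closed {\<xi> \<in> sphere 0 1. ?g \<xi> \<le> s}"
    unfolding closed_sequential_limits
  proof (intro allI impI, elim conjE)
    fix X \<xi> assume X: "\<forall>n. X n \<in> {\<xi> \<in> sphere 0 1. ?g \<xi> \<le> s}" and lim: "X \<longlonglongrightarrow> \<xi>"
    have sph: "\<xi> \<in> sphere 0 1"
      using closed_sphere[of "0::complex" 1] X lim unfolding closed_sequential_limits by blast
    have le: "indicator (lusin_cone \<sigma> \<xi>) z * h z \<le> liminf (\<lambda>n. indicator (lusin_cone \<sigma> (X n)) z * h z)" for z
    proof (cases "z \<in> lusin_cone \<sigma> \<xi>")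
      case True
      have "(\<lambda>n. norm (1 - cnj (X n) * z)) \<longlonglongrightarrow> norm (1 - cnj \<xi> * z)"
        by (intro tendsto_intros lim)
      hence "eventually (\<lambda>n. norm (1 - cnj (X n) * z) < \<sigma> * (1 - norm z)) sequentially"
        using True by (intro order_tendstoD(2)) (auto simp: lusin_cone_def)
      hence "eventually (\<lambda>n. h z \<le> indicator (lusin_cone \<sigma> (X n)) z * h z) sequentially"
        using True by (auto simp: lusin_cone_def elim!: eventually_mono)
      hence "h z \<le> liminf (\<lambda>n. indicator (lusin_cone \<sigma> (X n)) z * h z)"
        by (rule Liminf_bounded)
      thus ?thesis using True by simp
    qed auto
    have "?g \<xi> \<le> (\<integral>\<^sup>+z. liminf (\<lambda>n. indicator (lusin_cone \<sigma> (X n)) z * h z) \<partial>\<mu>)"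
      by (intro nn_integral_mono le)
    also have "\<dots> \<le> liminf (\<lambda>n. ?g (X n))"
      by (rule nn_integral_liminf) (rule m, measurable)
    also have "\<dots> \<le> liminf (\<lambda>n. s)"
      using X by (intro Liminf_mono) auto
    finally show "\<xi> \<in> {\<xi> \<in> sphere 0 1. ?g \<xi> \<le> s}" using sph by (simp add: Liminf_const)
  qed
  hence "sphere 0 1 - {\<xi> \<in> sphere 0 1. ?g \<xi> \<le> s} \<in> sets borel"
    by (intro sets.Diff borel_closed) auto
  also have "sphere 0 1 - {\<xi> \<in> sphere 0 1. ?g \<xi> \<le> s} = {\<xi> \<in> sphere 0 1. s < ?g \<xi>}"
    by (auto simp: not_le)
  finally show ?thesis .
qed

section \<open>From the weak estimate to the measure of disks\<close>

lemma circle_measure_Int_sphere: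
  assumes "A \<in> sets borel"
  shows "emeasure circle_measure (A \<inter> sphere 0 1) = emeasure circle_measure A"
proof -
  have "cis -` (A \<inter> sphere 0 1) = cis -` A" by auto
  moreover have "A \<inter> sphere 0 1 \<in> sets borel" using assms by (intro sets.Int) auto
  ultimately show ?thesis using assms by (simp add: emeasure_circle_measure)
qed

text \<open>Arguing by contradiction replaces the mass of the disk, which may be infinite, by a
  finite level \<open>s\<close> that the left-hand function exceeds on an arc of length at least
  \<open>c * d\<close>.\<close>

lemma ball_le_of_weak_estimate:
  fixes \<mu> :: "complex measure"
  assumes q: "q \<ge> 1" and al: "\<alpha> > -1" and sig: "\<sigma> > 1" and sets: "sets \<mu> = sets borel" and C0: "C0 > 0"
    and A: "\<And>f. f holomorphic_on ball 0 1 \<Longrightarrow>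
        weak_Lq_norm q (\<lambda>\<xi>. \<integral>\<^sup>+ z. indicator (lusin_cone \<sigma> \<xi>) z * ennreal (norm (f z) / (1 - norm z)) \<partial>\<mu>)
        \<le> ennreal C0 * weak_Lq_norm q (\<lambda>\<xi>. \<integral>\<^sup>+ z. indicator (lusin_cone \<sigma> \<xi>) z *
                    ennreal (norm (f z) * (1 - norm z) powr (\<alpha> - 1)) \<partial>area_measure)"
  obtains \<epsilon> C where "0 < \<epsilon>" "\<epsilon> \<le> 1" "C > 0"
    "\<And>z. norm z < 1 \<Longrightarrow> emeasure \<mu> (ball z (\<epsilon> * (1 - norm z))) \<le> ennreal (C * (1 - norm z) powr (\<alpha> + 2))"
proof -
  \<comment> \<open>An integer exponent keeps the test function rational, and
    \<open>n \<ge> \<alpha> + 2\<close> gives \<open>m \<ge> 1\<close>, the decay that the pole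
    estimate asks for.\<close>
  define n where "n = nat \<lceil>\<alpha> + 2\<rceil>"
  define m where "m = real n - \<alpha> - 1"
  have "real n \<ge> \<alpha> + 2" unfolding n_def by linarith
  hence m: "real n = m + \<alpha> + 1" "m \<ge> 1" by (auto simp: m_def)
  obtain K where K: "K > 0" "\<And>\<xi> z. \<xi> \<in> sphere 0 1 \<Longrightarrow> z \<in> ball 0 1 \<Longrightarrow>
    (\<integral>\<^sup>+w. indicator (lusin_cone \<sigma> \<xi>) w * ennreal (norm (1 / (1 - cnj z * w) ^ n) * (1 - norm w) powr (\<alpha> - 1)) \<partial>area_measure)
      \<le> ennreal (K * norm (\<xi> - z) powr (- m))"
    using cone_integral_test_function_le[OF al sig m(1)] m(2) by auto
  define K3 where "K3 = K * (6 * pi) powr (1/q)"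
  have K3: "K3 > 0" using K by (simp add: K3_def)
  \<comment> \<open>Solves \<open>(1 + \<sigma>) / 2 + \<epsilon> = \<sigma> * (1 -
    \<epsilon>)\<close>: every vertex within \<open>(1 + \<sigma>) / 2 * d\<close> of
    \<open>z\<close> then has the whole disk of radius \<open>\<epsilon> * d\<close> in its
    cone.\<close>
  define \<epsilon> where "\<epsilon> = (\<sigma> - 1) / (2 * (1 + \<sigma>))"
  have eps: "0 < \<epsilon>" "\<epsilon> \<le> 1" using sig by (auto simp: \<epsilon>_def divide_le_eq)
  have es: "(1 + \<sigma>) / 2 + \<epsilon> \<le> \<sigma> * (1 - \<epsilon>)"
    using sig by (simp add: \<epsilon>_def field_simps)
  define c where "c = min ((\<sigma> - 1) / 2) 1"
  have c: "c > 0" using sig by (simp add: c_def)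
  \<comment> \<open>\<open>3 ^ n\<close> and 2 come from
    \<open>norm (1 - cnj z * w) \<le> 3 * d\<close> and \<open>1 - norm w \<le> 2 * d\<close> on the
    small disk, the power of \<open>c\<close> from the length of the arc. The summand 1 makes the
    final inequality contradictory.\<close>
  define C where "C = (C0 * K3 + 1) * 3 ^ n * 2 * c powr (- (1/q))"
  have C: "C > 0" using C0 K3 c by (auto simp: C_def intro!: mult_pos_pos add_nonneg_pos)
  have "emeasure \<mu> (ball z (\<epsilon> * (1 - norm z))) \<le> ennreal (C * (1 - norm z) powr (\<alpha> + 2))" if z: "norm z < 1" for z
  proof (rule ccontr)
    define d where "d = 1 - norm z"
    have d: "0 < d" "d \<le> 1" using z by (auto simp: d_def)
    assume "\<not> ?thesis"
    hence big: "ennreal (C * d powr (\<alpha> + 2)) < emeasure \<mu> (ball z (\<epsilon> * d))" by (simp add: not_le d_def)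
    define f where "f = (\<lambda>w. 1 / (1 - cnj z * w) ^ n)"
    have nz: "1 - cnj z * w \<noteq> 0" if "norm w < 1" for w
      using norm_one_minus_cnj_ge[of w z] that z by auto
    have hol: "f holomorphic_on ball 0 1"
      unfolding f_def using nz by (intro holomorphic_intros) auto
    have fm [measurable]: "f \<in> borel_measurable borel" unfolding f_def by measurable
    define V where "V = 1 / ((3 * d) ^ n * (2 * d))"
    have V: "V > 0" using d by (simp add: V_def)
    define s where "s = V * (C * d powr (\<alpha> + 2))"
    have s: "s > 0" using V C d by (simp add: s_def)
    let ?g = "\<lambda>\<xi>. \<integral>\<^sup>+ w. indicator (lusin_cone \<sigma> \<xi>) w * ennreal (norm (f w) / (1 - norm w)) \<partial>\<mu>"
    let ?S = "{\<xi> \<in> sphere 0 1. ennreal s < ?g \<xi>}"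
    have Sb: "?S \<in> sets borel" by (rule cone_superlevel_borel[OF sets]) measurable
    have "ball z ((1 + \<sigma>) / 2 * d) \<inter> sphere 0 1 \<subseteq> ?S"
    proof
      fix \<xi> assume "\<xi> \<in> ball z ((1 + \<sigma>) / 2 * d) \<inter> sphere 0 1"
      hence xi: "\<xi> \<in> sphere 0 1" "norm (\<xi> - z) < (1 + \<sigma>) / 2 * d" by (auto simp: dist_norm norm_minus_commute)
      have le: "ennreal V * indicator (ball z (\<epsilon> * d)) w \<le> indicator (lusin_cone \<sigma> \<xi>) w * ennreal (norm (f w) / (1 - norm w))" for w
      proof (cases "w \<in> ball z (\<epsilon> * d)")
        case True
        hence w: "norm (w - z) < \<epsilon> * d" by (simp add: dist_norm norm_minus_commute)
        have ed: "\<epsilon> * d \<le> d" using eps d by simp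
        have tri: "\<bar>norm w - norm z\<bar> \<le> norm (w - z)" by (rule norm_triangle_ineq3)
        have w1: "norm w < 1" using tri w ed by (simp add: d_def)
        have dw: "(1 - \<epsilon>) * d \<le> 1 - norm w" "1 - norm w \<le> 2 * d"
          using tri w ed by (auto simp: d_def algebra_simps)
        have "norm (\<xi> - w) \<le> norm (\<xi> - z) + norm (w - z)"
          using norm_triangle_ineq4[of "\<xi> - z" "w - z"] by simp
        also have "\<dots> < ((1 + \<sigma>) / 2 + \<epsilon>) * d" using add_strict_mono[OF xi(2) w] by (simp only: distrib_right)
        also have "\<dots> \<le> \<sigma> * (1 - \<epsilon>) * d" using es d by (intro mult_right_mono) auto
        also have "\<dots> \<le> \<sigma> * (1 - norm w)" using mult_left_mono[OF dw(1), of \<sigma>] sig by (simp add: mult.assoc)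
        finally have cone: "w \<in> lusin_cone \<sigma> \<xi>" using lusin_cone_iff[OF xi(1)] w1 by simp
        have "norm (1 - cnj z * w) \<le> 2 * d + norm (w - z)"
          using norm_one_minus_cnj_le[of z w] z by (simp add: d_def)
        hence u: "norm (1 - cnj z * w) \<le> 3 * d" using w ed by linarith
        have u0: "norm (1 - cnj z * w) > 0" using nz[OF w1] by simp
        have "V = 1 / ((3 * d) ^ n) * (1 / (2 * d))" by (simp add: V_def)
        also have "\<dots> \<le> norm (f w) * (1 / (1 - norm w))"
        proof (rule mult_mono)
          show "1 / ((3 * d) ^ n) \<le> norm (f w)"
            unfolding f_def norm_divide norm_power norm_one
            using u u0 d by (intro divide_left_mono power_mono mult_pos_pos zero_less_power) auto
          show "1 / (2 * d) \<le> 1 / (1 - norm w)"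
            using dw w1 d by (intro divide_left_mono) auto
        qed (use d in auto)
        finally have "V \<le> norm (f w) / (1 - norm w)" by simp
        thus ?thesis using cone True by (simp add: ennreal_leI)
      qed auto
      have "ennreal s = ennreal V * ennreal (C * d powr (\<alpha> + 2))"
        using V C by (simp add: s_def ennreal_mult)
      also have "\<dots> < ennreal V * emeasure \<mu> (ball z (\<epsilon> * d))"
        using big V by (intro ennreal_mult_strict_left_mono) auto
      also have "\<dots> = (\<integral>\<^sup>+w. ennreal V * indicator (ball z (\<epsilon> * d)) w \<partial>\<mu>)"
        by (subst nn_integral_cmult_indicator) (auto simp: sets)
      also have "\<dots> \<le> ?g \<xi>" by (intro nn_integral_mono le)
      finally show "\<xi> \<in> ?S" using xi by simp
    qed
    hence "emeasure circle_measure (ball z ((1 + \<sigma>) / 2 * d) \<inter> sphere 0 1) \<le> emeasure circle_measure ?S"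
      using Sb by (intro emeasure_mono) auto
    hence "emeasure circle_measure (ball z ((1 + \<sigma>) / 2 * d)) \<le> emeasure circle_measure ?S"
      by (subst (asm) circle_measure_Int_sphere) auto
    moreover have "ennreal (c * d) \<le> emeasure circle_measure (ball z ((1 + \<sigma>) / 2 * d))"
      proof -
      have "(1 + \<sigma>) / 2 - 1 = (\<sigma> - 1) / 2" by (simp add: field_simps)
      thus ?thesis using circle_measure_ball_ge[OF z, of "(1 + \<sigma>) / 2"] sig by (simp add: c_def d_def)
    qed
    ultimately have "ennreal (c * d) \<le> ennreal (measure circle_measure ?S)"
      by (simp add: circle.emeasure_eq_measure)
    hence cd: "c * d \<le> measure circle_measure ?S" by simp
    have "ennreal (s * (c * d) powr (1/q)) \<le> ennreal (s * measure circle_measure ?S powr (1/q))"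
      using cd c d s q by (intro ennreal_leI mult_left_mono powr_mono2) auto
    also have "\<dots> \<le> weak_Lq_norm q ?g"
      unfolding weak_Lq_norm_def using s by (intro SUP_upper2[of s]) auto
    also have "\<dots> \<le> ennreal C0 * weak_Lq_norm q (\<lambda>\<xi>. \<integral>\<^sup>+ w. indicator (lusin_cone \<sigma> \<xi>) w *
                    ennreal (norm (f w) * (1 - norm w) powr (\<alpha> - 1)) \<partial>area_measure)"
      by (rule A[OF hol])
    also have "\<dots> \<le> ennreal C0 * ennreal (K3 * d powr (1/q - m))"
      unfolding K3_def d_def using K z q m
      by (intro mult_left_mono weak_Lq_norm_le_of_pole) (auto simp: f_def)
    also have "\<dots> = ennreal (C0 * K3 * d powr (1/q - m))"
      using C0 K3 by (simp add: ennreal_mult mult.assoc)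
    finally have "s * (c * d) powr (1/q) \<le> C0 * K3 * d powr (1/q - m)"
      using C0 K3 by (subst (asm) ennreal_le_iff) auto
    moreover have "s * (c * d) powr (1/q) = (C0 * K3 + 1) * d powr (1/q - m)"
    proof -
      have 1: "V * (3 ^ n * 2) = d powr (- (real n + 1))"
      proof -
        have "d powr (- (real n + 1)) = 1 / (d ^ n * d)"
          using d by (simp only: powr_minus_divide powr_add powr_realpow powr_one)
        thus ?thesis using d by (simp add: V_def power_mult_distrib)
      qed
      have 2: "c powr (- (1/q)) * c powr (1/q) = 1"
        using c powr_add[of c "- (1/q)" "1/q"] by simp
      have "s * (c * d) powr (1/q) = (C0 * K3 + 1) * (V * (3 ^ n * 2)) * (c powr (- (1/q)) * c powr (1/q)) * (d powr (\<alpha> + 2) * d powr (1/q))"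
        unfolding s_def C_def powr_mult by (simp only: ac_simps)
      also have "\<dots> = (C0 * K3 + 1) * (d powr (- (real n + 1)) * d powr (\<alpha> + 2) * d powr (1/q))"
        unfolding 1 2 by simp
      also have "d powr (- (real n + 1)) * d powr (\<alpha> + 2) * d powr (1/q) = d powr (1/q - m)"
        unfolding powr_add[symmetric] using m(1) by (intro arg_cong[of _ _ "(powr) d"]) simp
      finally show ?thesis .
    qed
    moreover have "d powr (1/q - m) > 0" using d by simp
    ultimately show False by (simp only: distrib_right mult_1_left)
  qed
  thus ?thesis using that eps C by blast
qed

text \<open>A disjoint subfamily is chosen whose fivefold enlargements cover the union. Each
  enlargement has circle measure at most \<open>30 * pi * r\<close>, while the pieces of
  \<open>E\<close> in the disjoint balls have measure at least \<open>\<eta> * r\<close> and add up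
  to at most that of \<open>E\<close>.\<close>

lemma circle_vitali:
  fixes W :: "complex set" and r :: "complex \<Rightarrow> real"
  assumes E: "E \<in> sets borel" and r: "\<And>w. w \<in> W \<Longrightarrow> 0 < r w \<and> r w \<le> B" and eta: "\<eta> > 0"
    and dense: "\<And>w. w \<in> W \<Longrightarrow> ennreal (\<eta> * r w) \<le> emeasure circle_measure (E \<inter> ball w (r w))"
  shows "emeasure circle_measure (\<Union>w\<in>W. ball w (r w)) \<le> ennreal (30 * pi / \<eta>) * emeasure circle_measure E"
proof -
  obtain C where C: "countable C" "C \<subseteq> W" "pairwise (\<lambda>i j. disjnt (ball i (r i)) (ball j (r j))) C"
    "(\<Union>w\<in>W. ball w (r w)) \<subseteq> (\<Union>i\<in>C. ball i (5 * r i))"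
    by (rule Vitali_covering_lemma_balls[where S = "\<Union>w\<in>W. ball w (r w)" and K = W and a = "\<lambda>w. w" and r = r and B = B])
       (use r in auto)
  \<comment> \<open>The countable subfamily is indexed by natural numbers, padded with empty sets,
    so that countable subadditivity and additivity apply as series.\<close>
  define I where "I = to_nat_on C ` C"
  define p where "p = from_nat_into C"
  have p: "p i \<in> C" if "i \<in> I" for i
    using that C(1) by (auto simp: I_def p_def)
  have pinj: "p i \<noteq> p j" if "i \<in> I" "j \<in> I" "i \<noteq> j" for i j
    using that C(1) by (auto simp: I_def p_def)
  define X where "X = (\<lambda>i. if i \<in> I then ball (p i) (5 * r (p i)) else {})"
  define Y where "Y = (\<lambda>i. if i \<in> I then E \<inter> ball (p i) (r (p i)) else {})"
  have "(\<Union>i\<in>C. ball i (5 * r i)) \<subseteq> (\<Union>i. X i)"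
  proof
    fix x assume "x \<in> (\<Union>i\<in>C. ball i (5 * r i))"
    then obtain i where i: "i \<in> C" "x \<in> ball i (5 * r i)" by blast
    hence "x \<in> X (to_nat_on C i)" using C(1) by (simp add: X_def I_def p_def)
    thus "x \<in> (\<Union>i. X i)" by blast
  qed
  with C(4) have "(\<Union>w\<in>W. ball w (r w)) \<subseteq> (\<Union>i. X i)" by (rule order_trans)
  hence "emeasure circle_measure (\<Union>w\<in>W. ball w (r w)) \<le> emeasure circle_measure (\<Union>i. X i)"
    by (rule emeasure_mono) (simp add: X_def)
  also have "\<dots> \<le> (\<Sum>i. emeasure circle_measure (X i))"
    by (rule emeasure_subadditive_countably) (auto simp: X_def)
  also have "\<dots> \<le> (\<Sum>i. ennreal (30 * pi / \<eta>) * emeasure circle_measure (Y i))"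
  proof (intro suminf_le)
    fix i
    show "emeasure circle_measure (X i) \<le> ennreal (30 * pi / \<eta>) * emeasure circle_measure (Y i)"
    proof (cases "i \<in> I")
      case True
      have W: "p i \<in> W" using p[OF True] C(2) by blast
      have "emeasure circle_measure (X i) \<le> ennreal (6 * pi * (5 * r (p i)))"
        using True r[OF W] unfolding X_def by (simp only: if_True, intro circle_measure_ball_le) simp
      also have "6 * pi * (5 * r (p i)) = 30 * pi / \<eta> * (\<eta> * r (p i))" using eta by simp
      also have "ennreal \<dots> = ennreal (30 * pi / \<eta>) * ennreal (\<eta> * r (p i))"
        using eta r[OF W] by (intro ennreal_mult) auto
      also have "\<dots> \<le> ennreal (30 * pi / \<eta>) * emeasure circle_measure (Y i)"
        using dense[OF W] True by (intro mult_left_mono) (auto simp: Y_def)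
      finally show ?thesis .
    qed (simp add: X_def)
  qed auto
  also have "\<dots> = ennreal (30 * pi / \<eta>) * (\<Sum>i. emeasure circle_measure (Y i))" by simp
  also have "(\<Sum>i. emeasure circle_measure (Y i)) = emeasure circle_measure (\<Union>i. Y i)"
  proof (rule suminf_emeasure)
    show "disjoint_family Y"
      unfolding disjoint_family_on_def
    proof (intro ballI impI)
      fix i j :: nat assume "i \<noteq> j"
      show "Y i \<inter> Y j = {}"
      proof (cases "i \<in> I \<and> j \<in> I")
        case True
        hence "disjnt (ball (p i) (r (p i))) (ball (p j) (r (p j)))"
          using C(3) p pinj \<open>i \<noteq> j\<close> unfolding pairwise_def by blast
        thus ?thesis by (auto simp: Y_def disjnt_def)
      qed (auto simp: Y_def)
    qed
  qed (use E in \<open>auto simp: Y_def\<close>)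
  also have "ennreal (30 * pi / \<eta>) * \<dots> \<le> ennreal (30 * pi / \<eta>) * emeasure circle_measure E"
    using E by (intro mult_left_mono emeasure_mono) (auto simp: Y_def split: if_splits)
  finally show ?thesis .
qed

section \<open>Weak $L^q$ functions and Tonelli's theorem on cones\<close>

lemma circle_measure_superlevel_le:
  fixes g :: "complex \<Rightarrow> ennreal"
  assumes q: "q > 0" and g [measurable]: "g \<in> borel_measurable borel"
    and N: "weak_Lq_norm q g \<le> ennreal N" "N > 0" and s: "s > 0"
  shows "emeasure circle_measure {\<xi>. ennreal s < g \<xi>} \<le> ennreal ((N / s) powr q)"
proof -
  have lev: "{\<xi>. ennreal s < g \<xi>} \<in> sets borel" by measurable
  have eq: "{\<xi> \<in> sphere 0 1. ennreal s < g \<xi>} = {\<xi>. ennreal s < g \<xi>} \<inter> sphere 0 1" by auto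
  define M where "M = measure circle_measure {\<xi> \<in> sphere 0 1. ennreal s < g \<xi>}"
  have "ennreal (s * M powr (1/q)) \<le> weak_Lq_norm q g"
    unfolding weak_Lq_norm_def M_def using s by (intro SUP_upper2[of s]) auto
  also note N(1)
  finally have "s * M powr (1/q) \<le> N" using N(2) by (subst (asm) ennreal_le_iff) auto
  hence "M powr (1/q) \<le> N / s" using s by (simp add: le_divide_eq mult.commute)
  hence "(M powr (1/q)) powr q \<le> (N / s) powr q" using q by (intro powr_mono2) auto
  moreover have "(M powr (1/q)) powr q = M" using q by (simp add: powr_powr M_def)
  ultimately have "M \<le> (N / s) powr q" by simp
  moreover have "emeasure circle_measure {\<xi>. ennreal s < g \<xi>} = ennreal M"
    using circle_measure_Int_sphere[OF lev] by (simp only: M_def eq circle.emeasure_eq_measure)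
  ultimately show ?thesis by (simp add: ennreal_leI)
qed

text \<open>For finite \<open>x\<close> above the base level, the summand of the last level strictly
  below \<open>x\<close> suffices. For \<open>x = top\<close> every indicator is 1 and the series
  diverges.\<close>

lemma ennreal_le_dyadic_sum:
  fixes x :: ennreal
  assumes s: "s > 0"
  shows "x \<le> ennreal s + (\<Sum>k. ennreal (2 * s * 2 ^ k) * indicator {y. ennreal (s * 2 ^ k) < y} x)"
proof (cases "\<exists>k. x \<le> ennreal (s * 2 ^ k)")
  case True
  define k where "k = (LEAST k. x \<le> ennreal (s * 2 ^ k))"
  have k: "x \<le> ennreal (s * 2 ^ k)" using True unfolding k_def by (rule LeastI_ex)
  show ?thesis
  proof (cases k)
    case 0
    thus ?thesis using k by (simp add: add_increasing2)
  next
    case (Suc j)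
    hence "\<not> x \<le> ennreal (s * 2 ^ j)"
      using not_less_Least[of j "\<lambda>k. x \<le> ennreal (s * 2 ^ k)"] by (simp add: k_def)
    hence "x \<le> ennreal (2 * s * 2 ^ j) * indicator {y. ennreal (s * 2 ^ j) < y} x"
      using k Suc by (simp add: not_le ac_simps)
    also have "\<dots> \<le> (\<Sum>k. ennreal (2 * s * 2 ^ k) * indicator {y. ennreal (s * 2 ^ k) < y} x)"
      by (rule ennreal_term_le_suminf)
    finally show ?thesis by (simp add: add_increasing)
  qed
next
  case False
  let ?S = "\<Sum>k. ennreal (2 * s * 2 ^ k) * indicator {y. ennreal (s * 2 ^ k) < y} x"
  have ge: "ennreal (2 * s * 2 ^ k) \<le> ?S" for k
    using ennreal_term_le_suminf[of "\<lambda>k. ennreal (2 * s * 2 ^ k) * indicator {y. ennreal (s * 2 ^ k) < y} x" k] False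
    by (simp add: not_le)
  have "?S = top"
  proof (rule ccontr)
    assume "?S \<noteq> top"
    then obtain r where r: "?S = ennreal r" "r \<ge> 0" by (cases ?S) auto
    obtain k where "r / (2 * s) < 2 ^ k" using real_arch_pow[of 2 "r / (2 * s)"] by auto
    hence "r < 2 * s * 2 ^ k" using s by (simp add: divide_less_eq mult.commute)
    thus False using ge[of k] r s by (simp add: ennreal_le_iff)
  qed
  thus ?thesis by simp
qed

text \<open>The cut \<open>s = N * m powr (- (1/q))\<close> balances the two parts: below it the
  integral over \<open>S\<close> is at most \<open>s * m\<close>, and above it the weak bound, used
  on the whole circle, gives \<open>2 * s * m\<close> times a geometric series of ratio
  \<open>2 powr (1 - q)\<close>. Here \<open>q > 1\<close> is decisive.\<close>

lemma weak_Lq_set_integral_le: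
  fixes g :: "complex \<Rightarrow> ennreal"
  assumes q: "q > 1" and g [measurable]: "g \<in> borel_measurable borel"
    and N: "weak_Lq_norm q g \<le> ennreal N" "N > 0" and S [measurable]: "S \<in> sets borel"
  shows "(\<integral>\<^sup>+\<xi>. g \<xi> * indicator S \<xi> \<partial>circle_measure)
           \<le> ennreal ((1 + 2 / (1 - 2 powr (1 - q))) * N * measure circle_measure S powr (1 - 1/q))"
proof (cases "measure circle_measure S = 0")
  case True
  hence "S \<in> null_sets circle_measure" by (auto intro!: null_setsI simp: circle.emeasure_eq_measure)
  hence "(\<integral>\<^sup>+\<xi>. g \<xi> * indicator S \<xi> \<partial>circle_measure) = 0" by (rule nn_integral_null_set)
  thus ?thesis by simp
next
  case False
  define m where "m = measure circle_measure S"
  have m: "m > 0" using False by (simp add: m_def zero_less_measure_iff)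
  define s where "s = N * m powr (- (1/q))"
  have s: "s > 0" using N m by (simp add: s_def)
  define x where "x = 2 powr (1 - q)"
  have x: "0 < x" "x < 1" using q powr_less_mono[of "1 - q" 0 2] by (auto simp: x_def)
  have Ns: "(N / s) powr q = m"
  proof -
    have "N / s = m powr (1/q)" using N m powr_minus_divide[of m "1/q"] by (simp add: s_def)
    thus ?thesis using m q by (simp add: powr_powr)
  qed
  have sm: "s * m = N * m powr (1 - 1/q)"
    using m powr_add[of m "- (1/q)" 1] by (simp add: s_def)
  have "(\<integral>\<^sup>+\<xi>. g \<xi> * indicator S \<xi> \<partial>circle_measure)
     \<le> (\<integral>\<^sup>+\<xi>. ennreal s * indicator S \<xi> + (\<Sum>k. ennreal (2 * s * 2 ^ k) * indicator {\<xi>. ennreal (s * 2 ^ k) < g \<xi>} \<xi>) \<partial>circle_measure)"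
  proof (rule nn_integral_mono)
    fix \<xi>
    have "indicator {y. ennreal (s * 2 ^ k) < y} (g \<xi>) = (indicator {\<xi>. ennreal (s * 2 ^ k) < g \<xi>} \<xi> :: ennreal)" for k
      by (simp add: indicator_def)
    with ennreal_le_dyadic_sum[OF s, of "g \<xi>"]
    show "g \<xi> * indicator S \<xi> \<le> ennreal s * indicator S \<xi> + (\<Sum>k. ennreal (2 * s * 2 ^ k) * indicator {\<xi>. ennreal (s * 2 ^ k) < g \<xi>} \<xi>)"
      by (cases "\<xi> \<in> S") simp_all
  qed
  also have "\<dots> = (\<integral>\<^sup>+\<xi>. ennreal s * indicator S \<xi> \<partial>circle_measure)
      + (\<Sum>k. \<integral>\<^sup>+\<xi>. ennreal (2 * s * 2 ^ k) * indicator {\<xi>. ennreal (s * 2 ^ k) < g \<xi>} \<xi> \<partial>circle_measure)"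
    by (subst nn_integral_add; (subst nn_integral_suminf)?; measurable)
  also have "(\<integral>\<^sup>+\<xi>. ennreal s * indicator S \<xi> \<partial>circle_measure) = ennreal (s * m)"
    using s by (subst nn_integral_cmult_indicator) (auto simp: circle.emeasure_eq_measure m_def ennreal_mult)
  also have "(\<Sum>k. \<integral>\<^sup>+\<xi>. ennreal (2 * s * 2 ^ k) * indicator {\<xi>. ennreal (s * 2 ^ k) < g \<xi>} \<xi> \<partial>circle_measure)
      \<le> (\<Sum>k. ennreal (2 * (s * m) * x ^ k))"
  proof (intro suminf_le)
    fix k
    have "(\<integral>\<^sup>+\<xi>. ennreal (2 * s * 2 ^ k) * indicator {\<xi>. ennreal (s * 2 ^ k) < g \<xi>} \<xi> \<partial>circle_measure)
       = ennreal (2 * s * 2 ^ k) * emeasure circle_measure {\<xi>. ennreal (s * 2 ^ k) < g \<xi>}"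
      by (rule nn_integral_cmult_indicator) measurable
    also have "\<dots> \<le> ennreal (2 * s * 2 ^ k) * ennreal ((N / (s * 2 ^ k)) powr q)"
      using q N s by (intro mult_left_mono circle_measure_superlevel_le) auto
    also have "\<dots> = ennreal (2 * s * 2 ^ k * (N / (s * 2 ^ k)) powr q)"
      using s by (simp add: ennreal_mult)
    also have "2 * s * 2 ^ k * (N / (s * 2 ^ k)) powr q = 2 * (s * m) * x ^ k"
    proof -
      have 1: "(N / (s * 2 ^ k)) powr q = m / (2 ^ k) powr q"
        using N s powr_divide[of "N / s" "2 ^ k" q] by (simp add: Ns)
      have 2: "(2 ^ k) powr q = (2 powr q) ^ k" by (rule power_powr_commute) simp
      have 3: "x = 2 / 2 powr q" using powr_diff[of 2 1 q] by (simp add: x_def)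
      show ?thesis unfolding 1 2 3 power_divide by simp
    qed
    finally show "(\<integral>\<^sup>+\<xi>. ennreal (2 * s * 2 ^ k) * indicator {\<xi>. ennreal (s * 2 ^ k) < g \<xi>} \<xi> \<partial>circle_measure)
       \<le> ennreal (2 * (s * m) * x ^ k)" .
  qed auto
  also have "(\<Sum>k. ennreal (2 * (s * m) * x ^ k)) = ennreal (2 * (s * m) / (1 - x))"
    using s m x by (intro suminf_ennreal_geometric) auto
  also have "ennreal (s * m) + ennreal (2 * (s * m) / (1 - x)) = ennreal ((1 + 2 / (1 - x)) * (s * m))"
    using s m x by (simp add: distrib_right flip: ennreal_plus)
  finally show ?thesis unfolding sm by (simp add: x_def m_def mult.assoc add_left_mono)
qed

lemma indicator_lusin_cone_measurable [measurable]:
  "(\<lambda>p. indicator (lusin_cone \<sigma> (fst p)) (snd p) :: ennreal) \<in> borel_measurable (borel \<Otimes>\<^sub>M borel)"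
proof -
  have [measurable]: "{p. snd p \<in> lusin_cone \<sigma> (fst p)} \<in> sets (borel \<Otimes>\<^sub>M borel)"
  proof -
    have "open {p :: complex \<times> complex. norm (snd p) < 1 \<and> norm (1 - cnj (fst p) * snd p) < \<sigma> * (1 - norm (snd p))}"
      by (intro open_Collect_conj open_Collect_less continuous_intros)
    hence "{p. snd p \<in> lusin_cone \<sigma> (fst p)} \<in> sets (borel :: (complex \<times> complex) measure)"
      by (simp add: lusin_cone_def borel_open)
    thus ?thesis unfolding borel_prod .
  qed
  have "(\<lambda>p. indicator (lusin_cone \<sigma> (fst p)) (snd p) :: ennreal) = indicator {p. snd p \<in> lusin_cone \<sigma> (fst p)}"
    by (auto simp: fun_eq_iff indicator_def)
  thus ?thesis by simp
qed

lemma cone_integral_measurable: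
  fixes \<nu> :: "complex measure" and h :: "complex \<Rightarrow> ennreal"
  assumes "sigma_finite_measure \<nu>" and sets: "sets \<nu> = sets borel" and h [measurable]: "h \<in> borel_measurable borel"
  shows "(\<lambda>\<xi>. \<integral>\<^sup>+z. indicator (lusin_cone \<sigma> \<xi>) z * h z \<partial>\<nu>) \<in> borel_measurable borel"
proof -
  interpret sigma_finite_measure \<nu> by fact
  note [measurable_cong] = sets
  show ?thesis by measurable
qed

lemma cone_integral_Tonelli:
  fixes \<nu> :: "complex measure" and h :: "complex \<Rightarrow> ennreal"
  assumes "sigma_finite_measure \<nu>" and sets: "sets \<nu> = sets borel" and h [measurable]: "h \<in> borel_measurable borel"
    and E [measurable]: "E \<in> sets borel"
  shows "(\<integral>\<^sup>+\<xi>. (\<integral>\<^sup>+z. indicator (lusin_cone \<sigma> \<xi>) z * h z \<partial>\<nu>) * indicator E \<xi> \<partial>circle_measure)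
       = (\<integral>\<^sup>+z. indicator (ball 0 1) z * h z * emeasure circle_measure (E \<inter> ball z (\<sigma> * (1 - norm z))) \<partial>\<nu>)"
proof -
  interpret \<nu>: sigma_finite_measure \<nu> by fact
  interpret pair_sigma_finite circle_measure \<nu> ..
  note [measurable_cong] = sets
  have "(\<integral>\<^sup>+\<xi>. (\<integral>\<^sup>+z. indicator (lusin_cone \<sigma> \<xi>) z * h z \<partial>\<nu>) * indicator E \<xi> \<partial>circle_measure)
      = (\<integral>\<^sup>+\<xi>. (\<integral>\<^sup>+z. indicator (lusin_cone \<sigma> \<xi>) z * h z * indicator E \<xi> \<partial>\<nu>) \<partial>circle_measure)"
    by (intro nn_integral_cong nn_integral_multc[symmetric]) measurable
  also have "\<dots> = (\<integral>\<^sup>+z. (\<integral>\<^sup>+\<xi>. indicator (lusin_cone \<sigma> \<xi>) z * h z * indicator E \<xi> \<partial>circle_measure) \<partial>\<nu>)"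
    by (rule Fubini'[symmetric]) measurable
  also have "\<dots> = (\<integral>\<^sup>+z. indicator (ball 0 1) z * h z * emeasure circle_measure (E \<inter> ball z (\<sigma> * (1 - norm z))) \<partial>\<nu>)"
  proof (intro nn_integral_cong)
    fix z
    show "(\<integral>\<^sup>+\<xi>. indicator (lusin_cone \<sigma> \<xi>) z * h z * indicator E \<xi> \<partial>circle_measure)
        = indicator (ball 0 1) z * h z * emeasure circle_measure (E \<inter> ball z (\<sigma> * (1 - norm z)))"
    proof (cases "norm z < 1")
      case False
      thus ?thesis by (simp add: lusin_cone_def)
    next
      case True
      \<comment> \<open>The cone condition agrees with the Euclidean disk only for unimodular
        vertices, so the two integrands are compared almost everywhere.\<close>
      have "AE \<xi> in circle_measure. \<xi> \<in> sphere 0 1"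
        by (rule AE_I[of _ _ "- sphere 0 1"]) (auto simp: circle_measure_off_sphere)
      hence "(\<integral>\<^sup>+\<xi>. indicator (lusin_cone \<sigma> \<xi>) z * h z * indicator E \<xi> \<partial>circle_measure)
          = (\<integral>\<^sup>+\<xi>. h z * indicator (E \<inter> ball z (\<sigma> * (1 - norm z))) \<xi> \<partial>circle_measure)"
        using True by (intro nn_integral_cong_AE)
          (auto elim!: eventually_mono simp: lusin_cone_iff indicator_def dist_norm norm_minus_commute)
      also have "\<dots> = h z * emeasure circle_measure (E \<inter> ball z (\<sigma> * (1 - norm z)))"
        by (rule nn_integral_cmult_indicator) simp
      finally show ?thesis using True by simp
    qed
  qed
  finally show ?thesis .
qed

lemma arc_density_measurable [measurable]:
  assumes [measurable]: "E \<in> sets borel"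
  shows "(\<lambda>w. emeasure circle_measure (E \<inter> ball w (K * (1 - norm w)))) \<in> borel_measurable borel"
proof -
  have [measurable]: "{p :: complex \<times> complex. dist (fst p) (snd p) < K * (1 - norm (fst p))} \<in> sets (borel \<Otimes>\<^sub>M borel)"
  proof -
    have "open {p :: complex \<times> complex. dist (fst p) (snd p) < K * (1 - norm (fst p))}"
      by (intro open_Collect_less continuous_intros)
    thus ?thesis unfolding borel_prod by (rule borel_open)
  qed
  have "(\<lambda>w. emeasure circle_measure (E \<inter> ball w (K * (1 - norm w))))
     = (\<lambda>w. \<integral>\<^sup>+\<xi>. indicator E \<xi> * indicator {p :: complex \<times> complex. dist (fst p) (snd p) < K * (1 - norm (fst p))} (w, \<xi>) \<partial>circle_measure)"
  proof
    fix w :: complex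
    have "emeasure circle_measure (E \<inter> ball w (K * (1 - norm w))) = (\<integral>\<^sup>+\<xi>. indicator (E \<inter> ball w (K * (1 - norm w))) \<xi> \<partial>circle_measure)"
      by (subst nn_integral_indicator) auto
    also have "\<dots> = (\<integral>\<^sup>+\<xi>. indicator E \<xi> * indicator {p :: complex \<times> complex. dist (fst p) (snd p) < K * (1 - norm (fst p))} (w, \<xi>) \<partial>circle_measure)"
      by (intro nn_integral_cong) (auto simp: indicator_def)
    finally show "emeasure circle_measure (E \<inter> ball w (K * (1 - norm w))) = \<dots>" .
  qed
  also have "\<dots> \<in> borel_measurable borel" by measurable
  finally show ?thesis .
qed

section \<open>Dyadic decomposition of arc densities\<close>

text \<open>Density is measured against \<open>6 * pi * r w\<close>, the upper bound for the circle
  measure of the ball, so it lies in \<open>(0, 1]\<close> when positive. If it is about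
  \<open>(1/2) ^ k\<close>, the whole ball of \<open>w\<close> lies in \<open>S k\<close>; the
  smaller ball of aperture \<open>\<sigma>\<close> does too, and its measure is comparable to
  \<open>1 - norm w\<close> by \<open>circle_measure_ball_ge\<close>.\<close>

lemma arc_density_decomposition:
  assumes sig: "\<sigma> > 1" and K: "K \<ge> \<sigma>" and E [measurable]: "E \<in> sets borel"
  obtains S where "\<And>j. S j \<in> sets borel"
    "\<And>j. measure circle_measure (S j) \<le> 10 * 2 ^ j * measure circle_measure E"
    "\<And>w. norm w < 1 \<Longrightarrow> emeasure circle_measure (E \<inter> ball w (K * (1 - norm w)))
       \<le> (\<Sum>j. ennreal (6 * pi * K / min (\<sigma> - 1) 1 * (1/2) ^ j) * emeasure circle_measure (S j \<inter> ball w (\<sigma> * (1 - norm w))))"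
proof -
  define r where "r = (\<lambda>w::complex. K * (1 - norm w))"
  define c where "c = min (\<sigma> - 1) 1"
  have c: "c > 0" using sig by (simp add: c_def)
  define \<eta> where "\<eta> = (\<lambda>j. (1/2) ^ Suc j * (6 * pi) :: real)"
  have eta: "\<eta> j > 0" for j by (simp add: \<eta>_def)
  define W where "W = (\<lambda>j. {w. norm w < 1 \<and> ennreal (\<eta> j * r w) \<le> emeasure circle_measure (E \<inter> ball w (r w))})"
  \<comment> \<open>A union of open balls, hence open without any measurability of
    \<open>W j\<close>.\<close>
  define S where "S = (\<lambda>j. \<Union>w\<in>W j. ball w (r w))"
  have K0: "K > 1" using sig K by simp
  have r: "0 < r w \<and> r w \<le> K" if "norm w < 1" for w
    using that K0 by (simp add: r_def mult_left_le)
  have S: "S j \<in> sets borel" for j unfolding S_def by (intro borel_open open_UN) auto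
  have mS: "measure circle_measure (S j) \<le> 10 * 2 ^ j * measure circle_measure E" for j
  proof -
    have "emeasure circle_measure (S j) \<le> ennreal (30 * pi / \<eta> j) * emeasure circle_measure E"
      unfolding S_def using r by (intro circle_vitali[OF E, of _ r K]) (auto simp: W_def eta)
    also have "30 * pi / \<eta> j = 10 * 2 ^ j" by (simp add: \<eta>_def power_divide)
    also have "ennreal (10 * 2 ^ j) * emeasure circle_measure E = ennreal (10 * 2 ^ j * measure circle_measure E)"
      by (simp add: circle.emeasure_eq_measure ennreal_mult)
    finally show ?thesis by (simp add: circle.emeasure_eq_measure)
  qed
  have dec: "emeasure circle_measure (E \<inter> ball w (K * (1 - norm w)))
       \<le> (\<Sum>j. ennreal (6 * pi * K / c * (1/2) ^ j) * emeasure circle_measure (S j \<inter> ball w (\<sigma> * (1 - norm w))))"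
    if w: "norm w < 1" for w
  proof -
    define v where "v = measure circle_measure (E \<inter> ball w (r w))"
    have ev: "emeasure circle_measure (E \<inter> ball w (K * (1 - norm w))) = ennreal v"
      by (simp add: v_def r_def circle.emeasure_eq_measure)
    show ?thesis
    proof (cases "v = 0")
      case True
      thus ?thesis unfolding ev by simp
    next
      case False
      define u where "u = 6 * pi * r w"
      have v0: "v > 0" using False by (simp add: v_def zero_less_measure_iff)
      have "emeasure circle_measure (E \<inter> ball w (r w)) \<le> emeasure circle_measure (ball w (r w))"
        by (intro emeasure_mono) auto
      also have "\<dots> \<le> ennreal u" unfolding u_def using r[OF w] by (intro circle_measure_ball_le) simp
      finally have "v \<le> u" using r[OF w] by (simp add: v_def circle.emeasure_eq_measure u_def)
      with v0 obtain k where k: "(1/2) ^ Suc k * u < v" "v \<le> (1/2) ^ k * u"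
        using ex_geometric_layer[of v u "1/2"] by auto
      have "\<eta> k * r w \<le> v" using k(1) by (simp add: \<eta>_def u_def ac_simps)
      hence "w \<in> W k" using w by (simp add: W_def v_def circle.emeasure_eq_measure ennreal_leI)
      hence "ball w (r w) \<subseteq> S k" by (auto simp: S_def)
      moreover have "ball w (\<sigma> * (1 - norm w)) \<subseteq> ball w (r w)"
        unfolding r_def using K w by (intro subset_ball mult_right_mono) auto
      ultimately have Sk: "S k \<inter> ball w (\<sigma> * (1 - norm w)) = ball w (\<sigma> * (1 - norm w))" by blast
      have "(1/2) ^ k * u = 6 * pi * K / c * (1/2) ^ k * (c * (1 - norm w))"
        using c by (simp add: u_def r_def)
      hence "ennreal v \<le> ennreal (6 * pi * K / c * (1/2) ^ k * (c * (1 - norm w)))"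
        using k(2) by (simp add: ennreal_leI)
      also have "\<dots> = ennreal (6 * pi * K / c * (1/2) ^ k) * ennreal (c * (1 - norm w))"
        using c K0 w by (intro ennreal_mult) auto
      also have "\<dots> \<le> ennreal (6 * pi * K / c * (1/2) ^ k) * emeasure circle_measure (S k \<inter> ball w (\<sigma> * (1 - norm w)))"
        unfolding Sk c_def using w sig by (intro mult_left_mono circle_measure_ball_ge) auto
      also have "\<dots> \<le> (\<Sum>j. ennreal (6 * pi * K / c * (1/2) ^ j) * emeasure circle_measure (S j \<inter> ball w (\<sigma> * (1 - norm w))))"
        by (rule ennreal_term_le_suminf)
      finally show ?thesis unfolding ev .
    qed
  qed
  show ?thesis using that[of S] S mS dec unfolding c_def by blast
qed

lemma emeasure_area_measure_UNIV_le: "emeasure area_measure UNIV \<le> 1"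
proof -
  have "emeasure area_measure UNIV = (\<integral>\<^sup>+z. ennreal (1/pi) * indicator (ball 0 1) (z::complex) \<partial>lborel)"
    unfolding area_measure_def by (subst emeasure_density) auto
  also have "\<dots> = ennreal (1/pi) * emeasure lborel (ball (0::complex) 1)"
    by (subst nn_integral_cmult_indicator) auto
  also have "\<dots> = 1" by (simp add: emeasure_ball unit_ball_vol_2 flip: ennreal_mult)
  finally show ?thesis by simp
qed

interpretation area: finite_measure area_measure
proof
  have "space area_measure = UNIV" by (simp add: area_measure_def)
  thus "emeasure area_measure (space area_measure) \<noteq> \<infinity>"
    using emeasure_area_measure_UNIV_le by (auto simp: top_unique)
qed

text \<open>This is the passage from aperture \<open>K\<close> on the left to aperture
  \<open>\<sigma>\<close> in the weak norm. The constant depends only on \<open>q\<close>,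
  \<open>\<sigma>\<close> and \<open>K\<close>, so the estimate can later be applied with
  \<open>E\<close> a superlevel set.\<close>

lemma area_tent_estimate:
  assumes q: "q > 1" and sig: "\<sigma> > 1" and K: "K \<ge> \<sigma>"
  shows "\<exists>C>0. \<forall>h N E. h \<in> borel_measurable borel \<longrightarrow> N > 0 \<longrightarrow> E \<in> sets borel \<longrightarrow>
    weak_Lq_norm q (\<lambda>\<xi>. \<integral>\<^sup>+z. indicator (lusin_cone \<sigma> \<xi>) z * h z \<partial>area_measure) \<le> ennreal N \<longrightarrow>
    (\<integral>\<^sup>+w. indicator (ball 0 1) w * h w * emeasure circle_measure (E \<inter> ball w (K * (1 - norm w))) \<partial>area_measure)
      \<le> ennreal (C * N * measure circle_measure E powr (1 - 1/q))"
proof -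
  define a where "a = 6 * pi * K / min (\<sigma> - 1) 1"
  have a: "a > 0" using sig K by (simp add: a_def)
  define Cq where "Cq = 1 + 2 / (1 - 2 powr (1 - q))"
  have Cq: "Cq > 0"
    using q powr_less_mono[of "1 - q" 0 2] by (auto simp: Cq_def intro!: add_pos_pos)
  define p where "p = 1 - 1/q"
  have p: "p \<ge> 0" using q by (simp add: p_def)
  define x where "x = 2 powr (- (1/q))"
  have x: "0 < x" "x < 1" using q powr_less_mono[of "- (1/q)" 0 2] by (auto simp: x_def)
  define C where "C = a * Cq * 10 powr p / (1 - x)"
  have "(\<integral>\<^sup>+w. indicator (ball 0 1) w * h w * emeasure circle_measure (E \<inter> ball w (K * (1 - norm w))) \<partial>area_measure)
      \<le> ennreal (C * N * measure circle_measure E powr p)"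
    if h [measurable]: "h \<in> borel_measurable borel" and N: "N > 0" and E [measurable]: "E \<in> sets borel"
      and wk: "weak_Lq_norm q (\<lambda>\<xi>. \<integral>\<^sup>+z. indicator (lusin_cone \<sigma> \<xi>) z * h z \<partial>area_measure) \<le> ennreal N" for h N E
  proof -
    let ?g = "\<lambda>\<xi>. \<integral>\<^sup>+z. indicator (lusin_cone \<sigma> \<xi>) z * h z \<partial>area_measure"
    define M where "M = measure circle_measure E"
    have M: "M \<ge> 0" by (simp add: M_def)
    have g: "?g \<in> borel_measurable borel"
      by (rule cone_integral_measurable[OF area.sigma_finite_measure_axioms]) auto
    obtain S where S [measurable]: "\<And>j. S j \<in> sets borel"
      and mS: "\<And>j. measure circle_measure (S j) \<le> 10 * 2 ^ j * M"
      and dec: "\<And>w. norm w < 1 \<Longrightarrow> emeasure circle_measure (E \<inter> ball w (K * (1 - norm w)))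
       \<le> (\<Sum>j. ennreal (a * (1/2) ^ j) * emeasure circle_measure (S j \<inter> ball w (\<sigma> * (1 - norm w))))"
      unfolding a_def M_def by (rule arc_density_decomposition[OF sig K E]) blast
    let ?e = "\<lambda>j w. emeasure circle_measure (S j \<inter> ball w (\<sigma> * (1 - norm w)))"
    have "(\<integral>\<^sup>+w. indicator (ball 0 1) w * h w * emeasure circle_measure (E \<inter> ball w (K * (1 - norm w))) \<partial>area_measure)
       \<le> (\<integral>\<^sup>+w. (\<Sum>j. ennreal (a * (1/2) ^ j) * (indicator (ball 0 1) w * h w * ?e j w)) \<partial>area_measure)"
    proof (rule nn_integral_mono)
      fix w
      show "indicator (ball 0 1) w * h w * emeasure circle_measure (E \<inter> ball w (K * (1 - norm w)))
         \<le> (\<Sum>j. ennreal (a * (1/2) ^ j) * (indicator (ball 0 1) w * h w * ?e j w))"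
      proof (cases "norm w < 1")
        case True
        have "h w * emeasure circle_measure (E \<inter> ball w (K * (1 - norm w)))
           \<le> h w * (\<Sum>j. ennreal (a * (1/2) ^ j) * ?e j w)"
          by (intro mult_left_mono dec True) simp
        also have "\<dots> = (\<Sum>j. h w * (ennreal (a * (1/2) ^ j) * ?e j w))" by simp
        finally show ?thesis using True by (simp add: mult.left_commute)
      qed simp
    qed
    also have "\<dots> = (\<Sum>j. \<integral>\<^sup>+w. ennreal (a * (1/2) ^ j) * (indicator (ball 0 1) w * h w * ?e j w) \<partial>area_measure)"
      by (rule nn_integral_suminf) measurable
    also have "\<dots> \<le> (\<Sum>j. ennreal (a * Cq * 10 powr p * N * M powr p * x ^ j))"
    proof (intro suminf_le)
      fix j
      have "(\<integral>\<^sup>+w. ennreal (a * (1/2) ^ j) * (indicator (ball 0 1) w * h w * ?e j w) \<partial>area_measure)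
         = ennreal (a * (1/2) ^ j) * (\<integral>\<^sup>+w. indicator (ball 0 1) w * h w * ?e j w \<partial>area_measure)"
        by (rule nn_integral_cmult) measurable
      \<comment> \<open>Tonelli from right to left: the arcs in \<open>?e j\<close> have aperture
        exactly \<open>\<sigma>\<close>, so the function whose weak norm is controlled
        reappears.\<close>
      also have "(\<integral>\<^sup>+w. indicator (ball 0 1) w * h w * ?e j w \<partial>area_measure) = (\<integral>\<^sup>+\<xi>. ?g \<xi> * indicator (S j) \<xi> \<partial>circle_measure)"
        by (rule cone_integral_Tonelli[OF area.sigma_finite_measure_axioms, symmetric]) auto
      also have "\<dots> \<le> ennreal (Cq * N * measure circle_measure (S j) powr p)"
        unfolding Cq_def p_def by (intro weak_Lq_set_integral_le q g wk N S)
      also have "\<dots> \<le> ennreal (Cq * N * (10 * 2 ^ j * M) powr p)"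
        using Cq N p by (intro ennreal_leI mult_left_mono powr_mono2 mS) auto
      also have "ennreal (a * (1/2) ^ j) * \<dots> = ennreal (a * (1/2) ^ j * (Cq * N * (10 * 2 ^ j * M) powr p))"
        using a Cq N by (intro ennreal_mult[symmetric]) auto
      also have "a * (1/2) ^ j * (Cq * N * (10 * 2 ^ j * M) powr p) = a * Cq * 10 powr p * N * M powr p * x ^ j"
      proof -
        have 1: "(10 * 2 ^ j * M) powr p = 10 powr p * (2 powr p) ^ j * M powr p"
          unfolding powr_mult by (simp only: power_powr_commute)
        have 2: "x = 1/2 * 2 powr p"
          using powr_diff[of 2 "1" "1/q"] powr_minus_divide[of 2 "1/q"] by (simp add: x_def p_def)
        show ?thesis unfolding 1 2 power_mult_distrib by (simp only: ac_simps)
      qed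
      finally show "(\<integral>\<^sup>+w. ennreal (a * (1/2) ^ j) * (indicator (ball 0 1) w * h w * ?e j w) \<partial>area_measure)
         \<le> ennreal (a * Cq * 10 powr p * N * M powr p * x ^ j)"
        by (simp add: mult_left_mono)
    qed auto
    also have "\<dots> = ennreal (a * Cq * 10 powr p * N * M powr p / (1 - x))"
      using a Cq N x by (intro suminf_ennreal_geometric) auto
    finally show ?thesis by (simp add: C_def M_def)
  qed
  moreover have "C > 0" using a Cq x by (simp add: C_def)
  ultimately show ?thesis unfolding p_def by blast
qed

lemma area_measure_submean:
  assumes f: "f holomorphic_on ball 0 1" and z: "norm z < 1"
    and F [measurable]: "F \<in> borel_measurable borel" and F0: "\<And>w. F w \<ge> 0" and Ff: "\<And>w. norm w < 1 \<Longrightarrow> F w = norm (f w)"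
  shows "ennreal (F z) \<le> ennreal (4 / (1 - norm z)\<^sup>2) * (\<integral>\<^sup>+w. ennreal (F w) * indicator (ball z ((1 - norm z) / 2)) w \<partial>area_measure)"
proof -
  define d where "d = 1 - norm z"
  have d: "d > 0" using z by (simp add: d_def)
  have sub: "ball z (d/2) \<subseteq> ball 0 1"
  proof
    fix w assume "w \<in> ball z (d/2)"
    hence "norm (w - z) < d/2" by (simp add: dist_norm norm_minus_commute)
    hence "norm w < 1" using norm_triangle_ineq3[of w z] d by (auto simp: d_def)
    thus "w \<in> ball 0 1" by simp
  qed
  have in01: "norm w < 1" if "w \<in> ball z (d/2)" for w using sub that by auto
  let ?I = "\<integral>\<^sup>+w. ennreal (F w) * indicator (ball z (d/2)) w \<partial>lborel"
  have "(\<integral>\<^sup>+w. ennreal (F w) * indicator (ball z (d/2)) w \<partial>area_measure)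
      = (\<integral>\<^sup>+w. ennreal (1/pi) * indicator (ball 0 1) w * (ennreal (F w) * indicator (ball z (d/2)) w) \<partial>lborel)"
    unfolding area_measure_def by (rule nn_integral_density) auto
  also have "\<dots> = (\<integral>\<^sup>+w. ennreal (1/pi) * (ennreal (F w) * indicator (ball z (d/2)) w) \<partial>lborel)"
    using sub by (intro nn_integral_cong) (auto simp: indicator_def)
  also have "\<dots> = ennreal (1/pi) * ?I"
    by (rule nn_integral_cmult) measurable
  finally have area: "(\<integral>\<^sup>+w. ennreal (F w) * indicator (ball z (d/2)) w \<partial>area_measure) = ennreal (1/pi) * ?I" .
  have "ennreal (F z * pi * (d/2)\<^sup>2) \<le> ?I"
    using d F0 Ff in01 by (intro area_submean[where f=f] holomorphic_on_subset[OF f sub] F) auto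
  hence "ennreal (4 / d\<^sup>2) * (ennreal (1/pi) * ennreal (F z * pi * (d/2)\<^sup>2)) \<le> ennreal (4 / d\<^sup>2) * (ennreal (1/pi) * ?I)"
    by (intro mult_left_mono) auto
  also have "ennreal (4 / d\<^sup>2) * (ennreal (1/pi) * ennreal (F z * pi * (d/2)\<^sup>2)) = ennreal (4 / d\<^sup>2 * (1/pi * (F z * pi * (d/2)\<^sup>2)))"
    using F0[of z] by (simp add: ennreal_mult[symmetric])
  also have "4 / d\<^sup>2 * (1/pi * (F z * pi * (d/2)\<^sup>2)) = F z"
    using d by (simp add: power_divide)
  finally show ?thesis by (simp add: area flip: d_def)
qed

section \<open>From Carleson boxes to the weak estimate\<close>

text \<open>\<open>F z\<close> is replaced by its mean over the disk of half the distance to the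
  circle and the integrals are exchanged. On such disks \<open>1 - norm z\<close> and
  \<open>1 - norm w\<close> are comparable, so integrating out \<open>z\<close> costs only the
  \<open>\<mu>\<close>-mass of a disk about \<open>w\<close>.\<close>

lemma carleson_integral_le_area:
  fixes \<mu> :: "complex measure"
  assumes sets: "sets \<mu> = sets borel" and "finite_measure \<mu>" and sig: "\<sigma> > 1"
    and C1: "C1 > 0" "\<And>w. norm w < 1 \<Longrightarrow> emeasure \<mu> (ball w (1 - norm w)) \<le> ennreal (C1 * (1 - norm w) powr (\<alpha> + 2))"
    and f: "f holomorphic_on ball 0 1"
    and F [measurable]: "F \<in> borel_measurable borel" and F0: "\<And>w. F w \<ge> 0" and Ff: "\<And>w. norm w < 1 \<Longrightarrow> F w = norm (f w)"
    and E [measurable]: "E \<in> sets borel"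
  shows "(\<integral>\<^sup>+z. indicator (ball 0 1) z * ennreal (F z / (1 - norm z)) * emeasure circle_measure (E \<inter> ball z (\<sigma> * (1 - norm z))) \<partial>\<mu>)
     \<le> ennreal (16 * C1) * (\<integral>\<^sup>+w. indicator (ball 0 1) w * ennreal (F w * (1 - norm w) powr (\<alpha> - 1))
           * emeasure circle_measure (E \<inter> ball w ((2 * \<sigma> + 1) * (1 - norm w))) \<partial>area_measure)"
proof -
  interpret \<mu>: finite_measure \<mu> by fact
  interpret pair_sigma_finite \<mu> area_measure ..
  note [measurable_cong] = sets
  define e where "e = (\<lambda>z. emeasure circle_measure (E \<inter> ball z (\<sigma> * (1 - norm z))))"
  define e' where "e' = (\<lambda>z. emeasure circle_measure (E \<inter> ball z ((2 * \<sigma> + 1) * (1 - norm z))))"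
  have [measurable]: "e \<in> borel_measurable borel" "e' \<in> borel_measurable borel"
    unfolding e_def e'_def by measurable
  \<comment> \<open>The relation \<open>dist z w < d / 2\<close> is weakened to one centred at
    \<open>w\<close>, so that for fixed \<open>w\<close> the points \<open>z\<close> fill a disk to
    which the bound \<open>C1\<close> applies.\<close>
  define U where "U = {p :: complex \<times> complex. norm (snd p) < 1 \<and> dist (fst p) (snd p) < 1 - norm (snd p)}"
  have [measurable]: "U \<in> sets (borel \<Otimes>\<^sub>M borel)"
  proof -
    have "open U" unfolding U_def
      by (intro open_Collect_conj open_Collect_less continuous_intros)
    thus ?thesis unfolding borel_prod by (rule borel_open)
  qed
  define H where "H = (\<lambda>z w. indicator U (z, w) * (ennreal (16 * F w / (1 - norm w) ^ 3) * e' w))"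
  have point: "indicator (ball 0 1) z * ennreal (F z / (1 - norm z)) * e z \<le> (\<integral>\<^sup>+w. H z w \<partial>area_measure)" for z
  proof (cases "norm z < 1")
    case False
    thus ?thesis by simp
  next
    case z: True
    define d where "d = 1 - norm z"
    have d: "d > 0" using z by (simp add: d_def)
    have "indicator (ball 0 1) z * ennreal (F z / (1 - norm z)) * e z = ennreal (1 / d) * e z * ennreal (F z)"
      using z d F0[of z] by (simp add: ac_simps divide_inverse ennreal_mult flip: d_def)
    also have "\<dots> \<le> ennreal (1 / d) * e z * (ennreal (4 / d\<^sup>2) * (\<integral>\<^sup>+w. ennreal (F w) * indicator (ball z (d / 2)) w \<partial>area_measure))"
      unfolding d_def by (intro mult_left_mono area_measure_submean[OF f z F F0 Ff]) auto
    also have "\<dots> = ennreal (4 / d ^ 3) * e z * (\<integral>\<^sup>+w. ennreal (F w) * indicator (ball z (d / 2)) w \<partial>area_measure)"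
    proof -
      have "ennreal (4 / d ^ 3) = ennreal (1 / d) * ennreal (4 / d\<^sup>2)"
        using d by (simp add: ennreal_mult[symmetric] power3_eq_cube power2_eq_square)
      thus ?thesis by (simp only: ac_simps)
    qed
    also have "\<dots> = (\<integral>\<^sup>+w. ennreal (4 / d ^ 3) * e z * (ennreal (F w) * indicator (ball z (d / 2)) w) \<partial>area_measure)"
      by (rule nn_integral_cmult[symmetric]) measurable
    also have "\<dots> \<le> (\<integral>\<^sup>+w. H z w \<partial>area_measure)"
    proof (rule nn_integral_mono)
      fix w
      show "ennreal (4 / d ^ 3) * e z * (ennreal (F w) * indicator (ball z (d / 2)) w) \<le> H z w"
      proof (cases "w \<in> ball z (d / 2)")
        case True
        define \<delta> where "\<delta> = 1 - norm w"
        have wz: "norm (w - z) < d / 2" using True by (simp add: dist_norm norm_minus_commute)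
        have tri: "\<bar>norm w - norm z\<bar> \<le> norm (w - z)" by (rule norm_triangle_ineq3)
        have \<delta>: "d < 2 * \<delta>" "2 * \<delta> < 3 * d" "\<delta> > 0"
          using tri wz d by (auto simp: \<delta>_def d_def)
        have "(z, w) \<in> U" using \<delta> wz by (simp add: U_def \<delta>_def dist_norm norm_minus_commute)
        moreover have "e z \<le> e' w"
        proof -
          \<comment> \<open>From \<open>dist w z < d / 2 < \<delta>\<close> and
            \<open>\<sigma> * d \<le> 2 * \<sigma> * \<delta>\<close>; this fixes the aperture
            \<open>2 * \<sigma> + 1\<close>.\<close>
          have "ball z (\<sigma> * d) \<subseteq> ball w ((2 * \<sigma> + 1) * \<delta>)"
          proof
            fix \<xi> assume "\<xi> \<in> ball z (\<sigma> * d)"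
            hence "dist z \<xi> < \<sigma> * d" by simp
            moreover have "dist w \<xi> \<le> dist w z + dist z \<xi>" by (rule dist_triangle)
            moreover have "\<sigma> * d \<le> \<sigma> * (2 * \<delta>)" using \<delta> sig by (intro mult_left_mono) auto
            ultimately show "\<xi> \<in> ball w ((2 * \<sigma> + 1) * \<delta>)"
              using wz \<delta> by (simp add: dist_norm algebra_simps)
          qed
          thus ?thesis unfolding e_def e'_def d_def[symmetric] \<delta>_def[symmetric]
            by (intro emeasure_mono) auto
        qed
        moreover have "4 / d ^ 3 \<le> 16 / \<delta> ^ 3"
        proof -
          have "(2 * \<delta>) ^ 3 \<le> (3 * d) ^ 3" using \<delta> by (intro power_mono) auto
          hence "8 * \<delta> ^ 3 \<le> 27 * d ^ 3" by (simp add: power_mult_distrib)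
          moreover have "d ^ 3 > 0" "\<delta> ^ 3 > 0" using d \<delta> by simp_all
          ultimately have "4 * \<delta> ^ 3 \<le> 16 * d ^ 3" by linarith
          thus ?thesis using d \<delta>(3) by (simp add: divide_le_eq le_divide_eq)
        qed
        ultimately have "ennreal (4 / d ^ 3) * e z * ennreal (F w) \<le> ennreal (16 / \<delta> ^ 3) * e' w * ennreal (F w)"
          by (intro mult_mono ennreal_leI) auto
        also have "\<dots> = H z w"
          using \<open>(z, w) \<in> U\<close> F0[of w] \<delta>(3)
          by (simp add: H_def ac_simps divide_inverse ennreal_mult flip: \<delta>_def)
        finally show ?thesis using True by simp
      qed simp
    qed
    finally show ?thesis .
  qed
  have "(\<integral>\<^sup>+z. indicator (ball 0 1) z * ennreal (F z / (1 - norm z)) * e z \<partial>\<mu>) \<le> (\<integral>\<^sup>+z. (\<integral>\<^sup>+w. H z w \<partial>area_measure) \<partial>\<mu>)"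
    by (intro nn_integral_mono point)
  also have "\<dots> = (\<integral>\<^sup>+w. (\<integral>\<^sup>+z. H z w \<partial>\<mu>) \<partial>area_measure)"
    unfolding H_def by (rule Fubini'[symmetric]) measurable
  also have "\<dots> \<le> (\<integral>\<^sup>+w. ennreal (16 * C1) * (indicator (ball 0 1) w * ennreal (F w * (1 - norm w) powr (\<alpha> - 1)) * e' w) \<partial>area_measure)"
  proof (rule nn_integral_mono)
    fix w
    show "(\<integral>\<^sup>+z. H z w \<partial>\<mu>) \<le> ennreal (16 * C1) * (indicator (ball 0 1) w * ennreal (F w * (1 - norm w) powr (\<alpha> - 1)) * e' w)"
    proof (cases "norm w < 1")
      case False
      hence "H z w = 0" for z by (simp add: H_def U_def)
      thus ?thesis by simp
    next
      case True
      define \<delta> where "\<delta> = 1 - norm w"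
      have \<delta>: "\<delta> > 0" using True by (simp add: \<delta>_def)
      have "(\<integral>\<^sup>+z. H z w \<partial>\<mu>) = (\<integral>\<^sup>+z. ennreal (16 * F w / \<delta> ^ 3) * e' w * indicator (ball w \<delta>) z \<partial>\<mu>)"
        using True by (intro nn_integral_cong) (auto simp: H_def U_def \<delta>_def indicator_def dist_commute)
      also have "\<dots> = ennreal (16 * F w / \<delta> ^ 3) * e' w * emeasure \<mu> (ball w \<delta>)"
        by (rule nn_integral_cmult_indicator) (simp add: sets)
      also have "\<dots> \<le> ennreal (16 * F w / \<delta> ^ 3) * e' w * ennreal (C1 * \<delta> powr (\<alpha> + 2))"
        unfolding \<delta>_def by (intro mult_left_mono C1(2) True) auto
      also have "\<dots> = ennreal (16 * F w / \<delta> ^ 3 * (C1 * \<delta> powr (\<alpha> + 2))) * e' w"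
        using \<delta> C1 F0[of w] by (subst ennreal_mult) (auto simp: ac_simps)
      also have "16 * F w / \<delta> ^ 3 * (C1 * \<delta> powr (\<alpha> + 2)) = 16 * C1 * (F w * \<delta> powr (\<alpha> - 1))"
      proof -
        have "\<delta> powr (\<alpha> + 2) = \<delta> powr (\<alpha> - 1) * \<delta> ^ 3"
          using \<delta> powr_add[of \<delta> "\<alpha> - 1" 3] by (simp add: add.commute)
        thus ?thesis using \<delta> by simp
      qed
      also have "ennreal \<dots> = ennreal (16 * C1) * ennreal (F w * \<delta> powr (\<alpha> - 1))"
        using C1 F0[of w] by (intro ennreal_mult) auto
      finally show ?thesis using True by (simp add: \<delta>_def mult.assoc)
    qed
  qed
  also have "\<dots> = ennreal (16 * C1) * (\<integral>\<^sup>+w. indicator (ball 0 1) w * ennreal (F w * (1 - norm w) powr (\<alpha> - 1)) * e' w \<partial>area_measure)"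
    by (rule nn_integral_cmult) measurable
  finally show ?thesis unfolding e_def e'_def .
qed

lemma weak_estimate_of_ball_le:
  fixes \<mu> :: "complex measure"
  assumes q: "q > 1" and sig: "\<sigma> > 1" and sets: "sets \<mu> = sets borel" and null: "emeasure \<mu> (- ball 0 1) = 0"
    and C1: "C1 > 0" "\<And>w. norm w < 1 \<Longrightarrow> emeasure \<mu> (ball w (1 - norm w)) \<le> ennreal (C1 * (1 - norm w) powr (\<alpha> + 2))"
  shows "\<exists>C>0. \<forall>f. f holomorphic_on ball 0 1 \<longrightarrow>
              weak_Lq_norm q (\<lambda>\<xi>. \<integral>\<^sup>+ z. indicator (lusin_cone \<sigma> \<xi>) z * ennreal (norm (f z) / (1 - norm z)) \<partial>\<mu>)
              \<le> ennreal C * weak_Lq_norm q (\<lambda>\<xi>. \<integral>\<^sup>+ z. indicator (lusin_cone \<sigma> \<xi>) z *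
                    ennreal (norm (f z) * (1 - norm z) powr (\<alpha> - 1)) \<partial>area_measure)"
proof -
  \<comment> \<open>The disk hypothesis at centre 0 already covers the unit disk and makes
    \<open>\<mu>\<close> finite.\<close>
  have "emeasure \<mu> UNIV \<le> emeasure \<mu> (ball 0 1) + emeasure \<mu> (- ball 0 1)"
    using emeasure_subadditive[of "ball 0 1" \<mu> "- ball 0 1"] by (simp add: sets)
  also have "\<dots> \<le> ennreal C1" using C1(2)[of 0] by (simp add: null)
  finally have fin: "emeasure \<mu> UNIV < \<infinity>" by (simp add: order_le_less_trans)
  have "space \<mu> = UNIV" using sets_eq_imp_space_eq[OF sets] by simp
  hence fm: "finite_measure \<mu>" using fin by (intro finite_measureI) auto
  interpret \<mu>: finite_measure \<mu> by fact
  obtain Ct where Ct: "Ct > 0" "\<And>h N E. h \<in> borel_measurable borel \<Longrightarrow> N > 0 \<Longrightarrow> E \<in> sets borel \<Longrightarrow>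
    weak_Lq_norm q (\<lambda>\<xi>. \<integral>\<^sup>+z. indicator (lusin_cone \<sigma> \<xi>) z * h z \<partial>area_measure) \<le> ennreal N \<Longrightarrow>
    (\<integral>\<^sup>+w. indicator (ball 0 1) w * h w * emeasure circle_measure (E \<inter> ball w ((2 * \<sigma> + 1) * (1 - norm w))) \<partial>area_measure)
      \<le> ennreal (Ct * N * measure circle_measure E powr (1 - 1/q))"
    using area_tent_estimate[OF q sig, of "2 * \<sigma> + 1"] sig by auto
  define C where "C = 16 * C1 * Ct"
  have C: "C > 0" using C1 Ct by (simp add: C_def)
  have main: "weak_Lq_norm q (\<lambda>\<xi>. \<integral>\<^sup>+ z. indicator (lusin_cone \<sigma> \<xi>) z * ennreal (norm (f z) / (1 - norm z)) \<partial>\<mu>)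
              \<le> ennreal C * weak_Lq_norm q (\<lambda>\<xi>. \<integral>\<^sup>+ z. indicator (lusin_cone \<sigma> \<xi>) z *
                    ennreal (norm (f z) * (1 - norm z) powr (\<alpha> - 1)) \<partial>area_measure)"
    if f: "f holomorphic_on ball 0 1" for f
  proof -
    \<comment> \<open>Cutting |f| off outside the disk gives a Borel function on the plane; cone
      integrals do not see the difference.\<close>
    define F where "F = (\<lambda>z. indicator (ball 0 1) z *\<^sub>R norm (f z))"
    have "continuous_on (ball 0 1) (\<lambda>z. norm (f z))"
      by (intro continuous_intros holomorphic_on_imp_continuous_on f)
    hence F [measurable]: "F \<in> borel_measurable borel"
      unfolding F_def by (intro borel_measurable_continuous_on_indicator) auto
    have F0: "F w \<ge> 0" for w by (simp add: F_def)
    have Ff: "F w = norm (f w)" if "norm w < 1" for w using that by (simp add: F_def)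
    let ?G = "\<lambda>\<xi>. \<integral>\<^sup>+ z. indicator (lusin_cone \<sigma> \<xi>) z * ennreal (F z / (1 - norm z)) \<partial>\<mu>"
    let ?g = "\<lambda>\<xi>. \<integral>\<^sup>+ z. indicator (lusin_cone \<sigma> \<xi>) z * ennreal (F z * (1 - norm z) powr (\<alpha> - 1)) \<partial>area_measure"
    \<comment> \<open>Stated for every positive majorant \<open>N\<close> because the right-hand
      norm may be 0 or infinite; the value 0 is reached afterwards by letting the excess
      \<open>e\<close> tend to 0.\<close>
    have bound: "weak_Lq_norm q ?G \<le> ennreal (C * N)" if N: "N > 0" "weak_Lq_norm q ?g \<le> ennreal N" for N
      unfolding weak_Lq_norm_def
    proof (intro SUP_least ennreal_leI)
      fix s :: real assume "s \<in> {0<..}"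
      hence s: "s > 0" by simp
      let ?S = "{\<xi> \<in> sphere 0 1. ennreal s < ?G \<xi>}"
      have S: "?S \<in> sets borel" by (rule cone_superlevel_borel[OF sets]) measurable
      define M where "M = measure circle_measure ?S"
      show "s * measure circle_measure ?S powr (1/q) \<le> C * N"
      proof (cases "M = 0")
        case True
        thus ?thesis using C N by (simp add: M_def)
      next
        case False
        hence M: "M > 0" by (simp add: M_def zero_less_measure_iff)
        have "ennreal (s * M) = (\<integral>\<^sup>+\<xi>. ennreal s * indicator ?S \<xi> \<partial>circle_measure)"
          using s S M by (subst nn_integral_cmult_indicator) (auto simp: M_def circle.emeasure_eq_measure ennreal_mult)
        also have "\<dots> \<le> (\<integral>\<^sup>+\<xi>. ?G \<xi> * indicator ?S \<xi> \<partial>circle_measure)"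
          by (intro nn_integral_mono) (auto simp: indicator_def)
        also have "\<dots> = (\<integral>\<^sup>+z. indicator (ball 0 1) z * ennreal (F z / (1 - norm z)) * emeasure circle_measure (?S \<inter> ball z (\<sigma> * (1 - norm z))) \<partial>\<mu>)"
          using S by (intro cone_integral_Tonelli \<mu>.sigma_finite_measure_axioms sets) auto
        also have "\<dots> \<le> ennreal (16 * C1) * (\<integral>\<^sup>+w. indicator (ball 0 1) w * ennreal (F w * (1 - norm w) powr (\<alpha> - 1))
           * emeasure circle_measure (?S \<inter> ball w ((2 * \<sigma> + 1) * (1 - norm w))) \<partial>area_measure)"
          by (rule carleson_integral_le_area[OF sets fm sig C1 f F F0 Ff S])
        also have "\<dots> \<le> ennreal (16 * C1) * ennreal (Ct * N * M powr (1 - 1/q))"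
          unfolding M_def by (intro mult_left_mono Ct(2) N S) auto
        also have "\<dots> = ennreal (C * N * M powr (1 - 1/q))"
          using C1 Ct N by (simp add: C_def mult.assoc flip: ennreal_mult)
        finally have "s * M \<le> C * N * M powr (1 - 1/q)"
          using C N by (subst (asm) ennreal_le_iff) auto
        \<comment> \<open>Splitting \<open>M\<close> into
          \<open>M powr (1/q) * M powr (1 - 1/q)\<close> exposes the level-set quantity; the second
          factor is positive and finite and cancels.\<close>
        moreover have "s * M = s * M powr (1/q) * M powr (1 - 1/q)"
          using M powr_add[of M "1/q" "1 - 1/q"] by simp
        ultimately have "s * M powr (1/q) * M powr (1 - 1/q) \<le> C * N * M powr (1 - 1/q)" by simp
        moreover have "M powr (1 - 1/q) > 0" using M by simp
        ultimately show ?thesis unfolding M_def by (rule mult_right_le_imp_le)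
      qed
    qed
    have lim: "weak_Lq_norm q ?G \<le> ennreal C * weak_Lq_norm q ?g"
    proof (cases "weak_Lq_norm q ?g = top")
      case True
      thus ?thesis using C by (simp add: ennreal_mult_top)
    next
      case False
      then obtain r where r: "weak_Lq_norm q ?g = ennreal r" "r \<ge> 0" by (cases "weak_Lq_norm q ?g") auto
      have "weak_Lq_norm q ?G \<le> ennreal (C * r) + ennreal e" if e: "e > 0" for e
      proof -
        have "weak_Lq_norm q ?G \<le> ennreal (C * (r + e / C))"
          using r e C by (intro bound) (auto intro!: add_nonneg_pos ennreal_leI)
        also have "C * (r + e / C) = C * r + e" using C by (simp add: distrib_left)
        also have "ennreal (C * r + e) = ennreal (C * r) + ennreal e" using C r e by (intro ennreal_plus) auto
        finally show ?thesis .
      qed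
      hence "weak_Lq_norm q ?G \<le> ennreal (C * r)" by (rule ennreal_le_epsilon)
      also have "\<dots> = ennreal C * weak_Lq_norm q ?g" using C r by (simp add: ennreal_mult)
      finally show ?thesis .
    qed
    have "ennreal (F z * c) * indicator (lusin_cone \<sigma> \<xi>) z = ennreal (norm (f z) * c) * indicator (lusin_cone \<sigma> \<xi>) z" for z c \<xi>
      by (auto simp: lusin_cone_def F_def indicator_def)
    hence eq: "indicator (lusin_cone \<sigma> \<xi>) z * ennreal (F z * c) = indicator (lusin_cone \<sigma> \<xi>) z * ennreal (norm (f z) * c)" for z c \<xi>
      by (simp add: mult.commute)
    \<comment> \<open>With the quotient written as a product, both weights have the form
      \<open>F z * c\<close>, so \<open>eq\<close> converts both sides at once.\<close>
    show ?thesis using lim unfolding divide_inverse eq .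
  qed
  thus ?thesis using C by blast
qed

theorem theorem1:
  fixes q \<alpha> \<sigma> t :: real and \<mu> :: "complex measure"
  assumes "q > 1" and "\<alpha> > -1" and "\<sigma> > 1" and "t > 0"
    and "sets \<mu> = sets borel" and "emeasure \<mu> (- ball 0 1) = 0"
  defines "A \<equiv> (\<exists>C>0. \<forall>f. f holomorphic_on ball 0 1 \<longrightarrow>
              weak_Lq_norm q (\<lambda>\<xi>. \<integral>\<^sup>+ z. indicator (lusin_cone \<sigma> \<xi>) z *
                    ennreal (norm (f z) / (1 - norm z)) \<partial>\<mu>)
              \<le> ennreal C * weak_Lq_norm q (\<lambda>\<xi>. \<integral>\<^sup>+ z. indicator (lusin_cone \<sigma> \<xi>) z *
                    ennreal (norm (f z) * (1 - norm z) powr (\<alpha> - 1)) \<partial>area_measure))"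
    and "B \<equiv> (\<exists>C>0. \<forall>z\<in>ball 0 1. emeasure \<mu> (bergman_disk z t) \<le> ennreal (C * (1 - norm z) powr (\<alpha> + 2)))"
    and "Cc \<equiv> (\<exists>C>0. \<forall>a h. 0 < h \<and> h \<le> 2*pi \<longrightarrow>
              emeasure \<mu> (carleson_box (arc a h) h) \<le> ennreal (C * h powr (\<alpha> + 2)))"
  shows "(A \<longleftrightarrow> B) \<and> (B \<longleftrightarrow> Cc)"
proof -
  note sets = assms(5)
  \<comment> \<open>Serves both implications into (c): \<open>\<epsilon>\<close> comes from the test
    function under (a), and is \<open>tanh t\<close> under (b).\<close>
  have ball_B: Cc if "0 < \<epsilon>" "\<epsilon> \<le> 1" "C > 0"
    "\<And>z. norm z < 1 \<Longrightarrow> emeasure \<mu> (ball z (\<epsilon> * (1 - norm z))) \<le> ennreal (C * (1 - norm z) powr (\<alpha> + 2))" for \<epsilon> C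
    unfolding Cc_def using carleson_box_le_of_ball_le[OF sets that(1,2) assms(2) that(3,4)] by blast
  have ball_bound: "\<exists>C>0. \<forall>z. norm z < 1 \<longrightarrow>
      emeasure \<mu> (ball z (R * (1 - norm z)) \<inter> ball 0 1) \<le> ennreal (C * (1 - norm z) powr (\<alpha> + 2))"
    if carl: Cc and R: "R > 0" for R
  proof -
    obtain C where C: "C > 0" and box: "\<forall>a h. 0 < h \<and> h \<le> 2*pi \<longrightarrow>
        emeasure \<mu> (carleson_box (arc a h) h) \<le> ennreal (C * h powr (\<alpha> + 2))"
      using carl unfolding Cc_def by blast
    have a2: "\<alpha> > -2" using assms(2) by linarith
    show ?thesis
    proof (intro exI conjI allI impI)
      show "C * (4 * pi * (R + 1)) powr (\<alpha> + 2) > 0" using C R by simp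
      fix z :: complex assume z: "norm z < 1"
      show "emeasure \<mu> (ball z (R * (1 - norm z)) \<inter> ball 0 1)
          \<le> ennreal (C * (4 * pi * (R + 1)) powr (\<alpha> + 2) * (1 - norm z) powr (\<alpha> + 2))"
        by (rule emeasure_ball_le_of_carleson[OF sets R a2 _ C z]) (simp add: box)
    qed
  qed
  have "A \<Longrightarrow> Cc"
  proof -
    assume A
    then obtain C0 where C0: "C0 > 0" and weak: "\<forall>f. f holomorphic_on ball 0 1 \<longrightarrow>
        weak_Lq_norm q (\<lambda>\<xi>. \<integral>\<^sup>+ z. indicator (lusin_cone \<sigma> \<xi>) z * ennreal (norm (f z) / (1 - norm z)) \<partial>\<mu>)
        \<le> ennreal C0 * weak_Lq_norm q (\<lambda>\<xi>. \<integral>\<^sup>+ z. indicator (lusin_cone \<sigma> \<xi>) z *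
                    ennreal (norm (f z) * (1 - norm z) powr (\<alpha> - 1)) \<partial>area_measure)"
      unfolding A_def by blast
    show Cc
      by (rule ball_le_of_weak_estimate[OF less_imp_le[OF assms(1)] assms(2,3) sets C0 weak[rule_format]])
        (assumption, rule ball_B)
  qed
  moreover have "B \<Longrightarrow> Cc"
  proof -
    assume B
    then obtain C where C: "C > 0"
      and disk: "\<forall>z\<in>ball 0 1. emeasure \<mu> (bergman_disk z t) \<le> ennreal (C * (1 - norm z) powr (\<alpha> + 2))"
      unfolding B_def by blast
    show Cc
    proof (rule ball_B[of "tanh t"])
      fix z :: complex assume z: "norm z < 1"
      have "bergman_disk z t = {w \<in> ball 0 1. norm (w - z) < tanh t * norm (1 - cnj z * w)}"
        using z by (auto simp: bergman_disk_def bergman_dist_less_iff)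
      also have "\<dots> \<in> sets borel" by measurable
      finally have "bergman_disk z t \<in> sets borel" .
      hence "emeasure \<mu> (ball z (tanh t * (1 - norm z))) \<le> emeasure \<mu> (bergman_disk z t)"
        using ball_subset_bergman_disk[OF z assms(4)] by (intro emeasure_mono) (auto simp: sets)
      also have "\<dots> \<le> ennreal (C * (1 - norm z) powr (\<alpha> + 2))" using disk z by simp
      finally show "emeasure \<mu> (ball z (tanh t * (1 - norm z))) \<le> ennreal (C * (1 - norm z) powr (\<alpha> + 2))" .
    qed (use assms(4) C tanh_real_lt_1[of t] in auto)
  qed
  moreover have "Cc \<Longrightarrow> B"
  proof -
    assume Cc
    have "2 / (1 - tanh t) > 0" using tanh_real_lt_1[of t] by simp
    from ball_bound[OF \<open>Cc\<close> this] obtain C where C: "C > 0" and ball: "\<forall>z. norm z < 1 \<longrightarrow>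
      emeasure \<mu> (ball z (2 / (1 - tanh t) * (1 - norm z)) \<inter> ball 0 1) \<le> ennreal (C * (1 - norm z) powr (\<alpha> + 2))"
      by blast
    have "emeasure \<mu> (bergman_disk z t) \<le> ennreal (C * (1 - norm z) powr (\<alpha> + 2))" if z: "norm z < 1" for z
    proof -
      have "emeasure \<mu> (bergman_disk z t) \<le> emeasure \<mu> (ball z (2 / (1 - tanh t) * (1 - norm z)) \<inter> ball 0 1)"
        using bergman_disk_subset_ball[OF z assms(4)] by (rule emeasure_mono) (simp add: sets)
      thus ?thesis using ball[rule_format, OF z] by (rule order_trans)
    qed
    thus B unfolding B_def using C by (intro exI[of _ C]) simp
  qed
  moreover have "Cc \<Longrightarrow> A"
  proof -
    assume Cc
    from ball_bound[OF \<open>Cc\<close> zero_less_one] obtain C where C: "C > 0" and ball: "\<forall>z. norm z < 1 \<longrightarrow>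
      emeasure \<mu> (ball z (1 * (1 - norm z)) \<inter> ball 0 1) \<le> ennreal (C * (1 - norm z) powr (\<alpha> + 2))"
      by blast
    \<comment> \<open>With \<open>R = 1\<close> the Euclidean disk is tangent to the circle from
      inside, so intersecting with the unit disk changes nothing.\<close>
    have eq: "ball z (1 - norm z) \<inter> ball 0 1 = ball z (1 - norm z)" for z :: complex
    proof -
      have "norm w < 1" if "dist z w < 1 - norm z" for w
        using that norm_triangle_ineq2[of w z] by (simp add: dist_norm norm_minus_commute)
      thus ?thesis by auto
    qed
    show A unfolding A_def
      by (rule weak_estimate_of_ball_le[OF assms(1,3) sets assms(6) C ball[rule_format, unfolded mult_1_left eq]])
  qed
  ultimately show ?thesis by blast
qed

end
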